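(* Let $d\ge 0$ and $d_0\in\{-1,0,\ldots,d-1\}$ be integers and let $k_0=\lfloor (d+1)/(d-d_0)\rfloor+1$. There exist $c=c(d)>0$ and $\underline n=\underline n(d)$ such that the following holds for all $n\ge\underline n$, all $2\le k\le n$ and all $\sigma>0$, where $Y=\theta+\varepsilon$ with $\varepsilon_1,\dots,\varepsilon_n$ i.i.d. $N(0,\sigma^2)$ under $\mathbb E_\theta$. (i) If $2\le k\le k_0$, then $$\inf_{\widetilde\theta}\sup_{\theta\in\Theta_n(d,d_0,k)}\mathbb E_\theta\|\widetilde\theta-\theta\|^2\ge c\,\sigma^2k\log\log(16n/k).$$ (ii) If $k\ge k_0+1$, then $$\inf_{\widetilde\theta}\sup_{\theta\in\Theta_n(d,d_0,k)}\mathbb E_\theta\|\widetilde\theta-\theta\|^2\ge c\,\sigma^2k\log(en/k).$$ In both displays the infimum is over all measurable functions $\widetilde\theta=\widetilde\theta(Y)\in\mathbb R^n$ of $Y$.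
   Context: $\|\cdot\|$ is the Euclidean norm. Spline class: $\mathcal F_n(d,d_0,k)$ is the set of functions $f:[0,1]\to\mathbb R$ for which there exist integers $0=n_0\le n_1\le\cdots\le n_k=n$ such that $n_i-n_{i-1}\ge d+1$ whenever $n_i>n_{i-1}$; $f$ is a polynomial of degree (at most) $d$ on each interval $(n_{i-1}/n,n_i/n]$; and $f^{(\ell)}((n_i/n)_-)=f^{(\ell)}((n_i/n)_+)$ (one-sided limits) for all $i\in\{1,\ldots,k-1\}$ with $0<n_i<n$ and all integers $0\le\ell\le d_0$ (no condition if $d_0=-1$). Further, $\Theta_n(d,d_0,k)=\{\theta\in\mathbb R^n:\theta_i=f(i/n),\ 1\le i\le n,\text{ for some }f\in\mathcal F_n(d,d_0,k)\}$. *)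

theory Defs
  imports "HOL-Probability.Probability" "HOL-Computational_Algebra.Polynomial"
begin

(* A function on [0,1] is represented by a total function on the reals; no condition involves
   its values outside (0,1]. The smoothness order d0 is an integer because -1 is allowed.
   The one-sided limits of the derivatives are required to exist and to agree. *)
definition spline_class :: "nat \<Rightarrow> nat \<Rightarrow> int \<Rightarrow> nat \<Rightarrow> (real \<Rightarrow> real) set" where
  "spline_class n d d0 k = {f. \<exists>m :: nat \<Rightarrow> nat.
      m 0 = 0 \<and> m k = n \<and>
      (\<forall>i\<in>{1..k}. m (i - 1) \<le> m i) \<and>
      (\<forall>i\<in>{1..k}. m (i - 1) < m i \<longrightarrow> m i - m (i - 1) \<ge> d + 1) \<and>
      (\<forall>i\<in>{1..k}. \<exists>p :: real poly. degree p \<le> d \<and>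
          (\<forall>x\<in>{real (m (i - 1)) / real n <.. real (m i) / real n}. f x = poly p x)) \<and>
      (\<forall>i\<in>{1..k - 1}. 0 < m i \<and> m i < n \<longrightarrow>
          (\<forall>l :: nat. int l \<le> d0 \<longrightarrow>
            (\<exists>L. (((deriv ^^ l) f) \<longlongrightarrow> L) (at_left (real (m i) / real n)) \<and>
                 (((deriv ^^ l) f) \<longlongrightarrow> L) (at_right (real (m i) / real n)))))}"

(* Vectors of length n are the extensional functions on {1..n}, i.e. the points of
   PiM {1..n} (\<lambda>_. borel). *)
definition spline_vectors :: "nat \<Rightarrow> nat \<Rightarrow> int \<Rightarrow> nat \<Rightarrow> (nat \<Rightarrow> real) set" where
  "spline_vectors n d d0 k = {\<theta> \<in> {1..n} \<rightarrow>\<^sub>E UNIV.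
      \<exists>f\<in>spline_class n d d0 k. \<forall>i\<in>{1..n}. \<theta> i = f (real i / real n)}"

abbreviation vec_space :: "nat \<Rightarrow> (nat \<Rightarrow> real) measure" where
  "vec_space n \<equiv> PiM {1..n} (\<lambda>_. borel)"

(* normal_density takes the standard deviation, so the variance is \<sigma>^2. *)
definition gaussian_noise :: "nat \<Rightarrow> real \<Rightarrow> (nat \<Rightarrow> real) measure" where
  "gaussian_noise n \<sigma> = PiM {1..n} (\<lambda>_. density lborel (normal_density 0 \<sigma>))"

definition observation :: "nat \<Rightarrow> (nat \<Rightarrow> real) \<Rightarrow> (nat \<Rightarrow> real) \<Rightarrow> (nat \<Rightarrow> real)" where
  "observation n \<theta> \<epsilon> = (\<lambda>i\<in>{1..n}. \<theta> i + \<epsilon> i)"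

(* The risk may be infinite, hence the nonnegative Lebesgue integral. *)
definition risk :: "nat \<Rightarrow> real \<Rightarrow> ((nat \<Rightarrow> real) \<Rightarrow> (nat \<Rightarrow> real)) \<Rightarrow> (nat \<Rightarrow> real) \<Rightarrow> ennreal" where
  "risk n \<sigma> T \<theta> =
     (\<integral>\<^sup>+ \<epsilon>. ennreal ((L2_set (\<lambda>i. T (observation n \<theta> \<epsilon>) i - \<theta> i) {1..n})\<^sup>2)
        \<partial>gaussian_noise n \<sigma>)"

definition minimax_risk :: "nat \<Rightarrow> real \<Rightarrow> (nat \<Rightarrow> real) set \<Rightarrow> ennreal" where
  "minimax_risk n \<sigma> \<Theta> =
     (INF T \<in> measurable (vec_space n) (vec_space n). SUP \<theta> \<in> \<Theta>. risk n \<sigma> T \<theta>)"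

end

theory Submission
  imports Defs
begin

text \<open>Both bounds come from a finite set of hypotheses. A prior that chooses one of \<open>N\<close> shifts of
  squared norm \<open>\<sigma>\<^sup>2 ln (N / 4)\<close>, pairwise separated by a constant multiple of that norm, cannot be
  detected, since the likelihood ratio of such a shift has second moment \<open>N / 4\<close>; the risk is
  therefore of order \<open>\<sigma>\<^sup>2 ln N\<close>. Independent choices in \<open>m\<close> disjoint blocks multiply this by
  \<open>m\<close>, because the other blocks only add a known shift.

  For (i) a single knot suffices: the truncated powers supported on the last \<open>B\<^sup>j\<close> coordinates, with
  \<open>B = 2 ^ (2 d + 3)\<close>, are almost orthogonal, and there are about \<open>ln n\<close> of them. For (ii),
  \<open>k0\<close> is the least number of knots that supports a spline of compact support. Such a bump has a
  bounded length on the lattice, so it can be placed in about \<open>n / k\<close> positions within each of about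
  \<open>k\<close> blocks.\<close>

text \<open>Otherwise the simplifier rewrites \<open>{1..n}\<close> to \<open>{Suc 0..n}\<close>.\<close>

declare One_nat_def [simp del]

section \<open>Gaussian shifts\<close>

text \<open>The rates differ because the hypotheses are counted differently. Scales must grow
  geometrically to stay nearly orthogonal, so their number is itself logarithmic and its logarithm
  is iterated; positions of a bump are counted linearly. The amplitude comes from the second moment
  of the likelihood ratio of a shift \<open>h\<close>, which is the exponential of the squared norm
  of \<open>h\<close> over \<open>\<sigma>\<^sup>2\<close>: it is the largest for which this stays
  within \<open>N / 4\<close>. In (i) the factor \<open>k\<close> is at most \<open>d + 2\<close>
  and disappears in the constant, so one block is enough. In (ii) the bound has to survive up to
  \<open>k = n\<close>, where the logarithm is 1 and every block still needs several positions; the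
  blocks therefore number about \<open>k / A\<close>, with \<open>A\<close> a multiple of
  \<open>(d + 1)\<^sup>2\<close>. The obstacle on the lattice is the gap of at least
  \<open>d + 1\<close> between distinct knots. Bump knots are placed at multiples of
  \<open>d + 1\<close>, so that any two of them coincide or are far enough apart, and neighbouring
  bumps may share a knot.\<close>

lemma nn_integral_normal_shift:
  fixes \<sigma> h :: real
  assumes "\<sigma> > 0" and [measurable]: "f \<in> borel_measurable borel"
  shows "(\<integral>\<^sup>+ x. f (h + x) \<partial>density lborel (normal_density 0 \<sigma>)) =
    (\<integral>\<^sup>+ x. ennreal (exp (h * x / \<sigma>\<^sup>2 - h\<^sup>2 / (2 * \<sigma>\<^sup>2))) * f x \<partial>density lborel (normal_density 0 \<sigma>))"
proof -
  have "(\<integral>\<^sup>+ x. f (h + x) \<partial>density lborel (normal_density 0 \<sigma>)) =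
      (\<integral>\<^sup>+ x. ennreal (normal_density 0 \<sigma> x) * f (h + x) \<partial>lborel)"
    by (subst nn_integral_density) auto
  also have "\<dots> = (\<integral>\<^sup>+ x. ennreal (normal_density 0 \<sigma> (x - h)) * f x \<partial>lborel)"
    by (subst (2) nn_integral_real_affine[where c = 1 and t = h]) auto
  also have "\<dots> = (\<integral>\<^sup>+ x. ennreal (normal_density 0 \<sigma> x) *
      (ennreal (exp (h * x / \<sigma>\<^sup>2 - h\<^sup>2 / (2 * \<sigma>\<^sup>2))) * f x) \<partial>lborel)"
  proof (rule nn_integral_cong)
    fix x
    \<comment> \<open>Completing the square; the result is the one-dimensional Cameron-Martin
      density.\<close>
    have "- (x - h)\<^sup>2 / (2 * \<sigma>\<^sup>2) = - x\<^sup>2 / (2 * \<sigma>\<^sup>2) + (h * x / \<sigma>\<^sup>2 - h\<^sup>2 / (2 * \<sigma>\<^sup>2))"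
      using \<open>\<sigma> > 0\<close> by (simp add: field_simps power2_eq_square)
    then have "normal_density 0 \<sigma> (x - h) =
        normal_density 0 \<sigma> x * exp (h * x / \<sigma>\<^sup>2 - h\<^sup>2 / (2 * \<sigma>\<^sup>2))"
      unfolding normal_density_def by (simp only: diff_0_right exp_add)
    then show "ennreal (normal_density 0 \<sigma> (x - h)) * f x = ennreal (normal_density 0 \<sigma> x) *
      (ennreal (exp (h * x / \<sigma>\<^sup>2 - h\<^sup>2 / (2 * \<sigma>\<^sup>2))) * f x)"
      by (simp add: ennreal_mult mult.assoc)
  qed
  also have "\<dots> = (\<integral>\<^sup>+ x. ennreal (exp (h * x / \<sigma>\<^sup>2 - h\<^sup>2 / (2 * \<sigma>\<^sup>2))) * f x
      \<partial>density lborel (normal_density 0 \<sigma>))"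
    by (subst nn_integral_density) auto
  finally show ?thesis .
qed

lemma sets_gaussian_noise [measurable_cong, simp]: "sets (gaussian_noise n \<sigma>) = sets (vec_space n)"
  unfolding gaussian_noise_def by (rule sets_PiM_cong) auto

lemma space_gaussian_noise [simp]: "space (gaussian_noise n \<sigma>) = space (vec_space n)"
  by (rule sets_eq_imp_space_eq) simp

lemma prob_space_gaussian_noise: "\<sigma> > 0 \<Longrightarrow> prob_space (gaussian_noise n \<sigma>)"
  unfolding gaussian_noise_def by (intro prob_space_PiM prob_space_normal_density)

lemma nn_integral_gaussian_noise_prod:
  assumes "\<sigma> > 0" "\<And>i. i \<in> {1..n} \<Longrightarrow> f i \<in> borel_measurable borel"
  shows "(\<integral>\<^sup>+ \<epsilon>. (\<Prod>i\<in>{1..n}. f i (\<epsilon> i)) \<partial>gaussian_noise n \<sigma>) =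
    (\<Prod>i\<in>{1..n}. \<integral>\<^sup>+ x. f i x \<partial>density lborel (normal_density 0 \<sigma>))"
proof -
  interpret prob_space "density lborel (normal_density 0 \<sigma>)"
    using assms by (intro prob_space_normal_density)
  interpret product_sigma_finite "\<lambda>_. density lborel (normal_density 0 \<sigma>)"
    by standard
  show ?thesis
    unfolding gaussian_noise_def using assms by (intro product_nn_integral_prod) auto
qed

lemma measurable_shift [measurable]: "(\<lambda>\<epsilon>. \<lambda>i\<in>{1..n}. h i + \<epsilon> i) \<in> measurable (vec_space n) (vec_space n)"
  by measurable

text \<open>The density of Gaussian noise with mean \<open>h\<close> with respect to centred noise.
  Only the values of \<open>h\<close> on \<open>{1..n}\<close> are read, so a shift may be given as
  a total function.\<close>

definition likelihood_ratio :: "nat \<Rightarrow> real \<Rightarrow> (nat \<Rightarrow> real) \<Rightarrow> (nat \<Rightarrow> real) \<Rightarrow> real" where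
  "likelihood_ratio n \<sigma> h \<epsilon> = (\<Prod>i\<in>{1..n}. exp (h i * \<epsilon> i / \<sigma>\<^sup>2 - (h i)\<^sup>2 / (2 * \<sigma>\<^sup>2)))"

lemma measurable_likelihood_ratio [measurable]:
  "likelihood_ratio n \<sigma> h \<in> borel_measurable (vec_space n)"
  unfolding likelihood_ratio_def by measurable

text \<open>Boxes generate the product sigma-algebra and are closed under intersection. The
  indicator of a box factors over the coordinates, and each factor is a one-dimensional
  shift.\<close>

lemma distr_gaussian_noise_shift:
  assumes "\<sigma> > 0"
  shows "distr (gaussian_noise n \<sigma>) (vec_space n) (\<lambda>\<epsilon>. \<lambda>i\<in>{1..n}. h i + \<epsilon> i) =
    density (gaussian_noise n \<sigma>) (\<lambda>\<epsilon>. ennreal (likelihood_ratio n \<sigma> h \<epsilon>))" (is "?L = ?R")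
proof (rule measure_eqI_PiM_finite[where M = "\<lambda>_. borel" and I = "{1..n}" and A = "\<lambda>_. space (vec_space n)"])
  interpret G: prob_space "gaussian_noise n \<sigma>"
    using assms by (rule prob_space_gaussian_noise)
  let ?N = "density lborel (normal_density 0 \<sigma>)"
  fix A :: "nat \<Rightarrow> real set" assume A: "\<And>i. i \<in> {1..n} \<Longrightarrow> A i \<in> sets borel"
  have [measurable]: "Pi\<^sub>E {1..n} A \<in> sets (vec_space n)"
    using A by (intro sets_PiM_I_finite) auto
  have ind: "indicator (Pi\<^sub>E {1..n} A) \<epsilon> = (\<Prod>i\<in>{1..n}. indicator (A i) (\<epsilon> i) :: ennreal)"
    if "\<epsilon> \<in> space (vec_space n)" for \<epsilon>
  proof (cases "\<epsilon> \<in> Pi\<^sub>E {1..n} A")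
    case False
    moreover have "\<epsilon> \<in> extensional {1..n}"
      using that by (simp add: space_PiM PiE_def)
    ultimately obtain i where "i \<in> {1..n}" "\<epsilon> i \<notin> A i"
      by (auto simp: PiE_iff)
    then have "(\<Prod>i\<in>{1..n}. indicator (A i) (\<epsilon> i) :: ennreal) = 0"
      by (intro prod_zero) (auto intro!: bexI[of _ i])
    then show ?thesis using False by simp
  qed (auto simp: PiE_iff)
  have "emeasure ?L (Pi\<^sub>E {1..n} A) =
      (\<integral>\<^sup>+ \<epsilon>. indicator (Pi\<^sub>E {1..n} A) \<epsilon> \<partial>?L)"
    by (simp add: nn_integral_indicator)
  also have "\<dots> = (\<integral>\<^sup>+ \<epsilon>. indicator (Pi\<^sub>E {1..n} A) (\<lambda>i\<in>{1..n}. h i + \<epsilon> i) \<partial>gaussian_noise n \<sigma>)"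
    by (subst nn_integral_distr) auto
  also have "\<dots> = (\<integral>\<^sup>+ \<epsilon>. (\<Prod>i\<in>{1..n}. indicator (A i) (h i + \<epsilon> i)) \<partial>gaussian_noise n \<sigma>)"
    by (intro nn_integral_cong) (subst ind, auto simp: space_PiM)
  also have "\<dots> = (\<Prod>i\<in>{1..n}. \<integral>\<^sup>+ x. indicator (A i) (h i + x) \<partial>?N)"
    using A assms by (intro nn_integral_gaussian_noise_prod) auto
  also have "\<dots> = (\<Prod>i\<in>{1..n}. \<integral>\<^sup>+ x. ennreal (exp (h i * x / \<sigma>\<^sup>2 - (h i)\<^sup>2 / (2 * \<sigma>\<^sup>2))) * indicator (A i) x \<partial>?N)"
    using A assms by (intro prod.cong refl nn_integral_normal_shift) auto
  also have "\<dots> = (\<integral>\<^sup>+ \<epsilon>. (\<Prod>i\<in>{1..n}. ennreal (exp (h i * \<epsilon> i / \<sigma>\<^sup>2 - (h i)\<^sup>2 / (2 * \<sigma>\<^sup>2))) * indicator (A i) (\<epsilon> i))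
      \<partial>gaussian_noise n \<sigma>)"
    using A assms by (intro nn_integral_gaussian_noise_prod[symmetric]) auto
  also have "\<dots> = (\<integral>\<^sup>+ \<epsilon>. ennreal (likelihood_ratio n \<sigma> h \<epsilon>) * indicator (Pi\<^sub>E {1..n} A) \<epsilon> \<partial>gaussian_noise n \<sigma>)"
    by (intro nn_integral_cong) (subst ind, auto simp: prod.distrib likelihood_ratio_def prod_ennreal)
  also have "\<dots> = emeasure ?R (Pi\<^sub>E {1..n} A)"
    by (subst emeasure_density) auto
  finally show "emeasure ?L (Pi\<^sub>E {1..n} A) = emeasure ?R (Pi\<^sub>E {1..n} A)" .
next
  interpret G: prob_space "gaussian_noise n \<sigma>"
    using assms by (rule prob_space_gaussian_noise)
  interpret L: prob_space ?L by (rule G.prob_space_distr) simp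
  show "emeasure ?L (space (vec_space n)) \<noteq> \<infinity>" by simp
  have "space (vec_space n) = Pi\<^sub>E {1..n} (\<lambda>_. UNIV)" by (simp add: space_PiM)
  also have "\<dots> \<in> prod_algebra {1..n} (\<lambda>_. borel)" by (rule prod_algebraI_finite) auto
  finally show "range (\<lambda>_. space (vec_space n)) \<subseteq> prod_algebra {1..n} (\<lambda>_. borel)" by blast
qed simp_all

lemma nn_integral_gaussian_noise_shift:
  assumes "\<sigma> > 0" and [measurable]: "F \<in> borel_measurable (vec_space n)"
  shows "(\<integral>\<^sup>+ \<epsilon>. F (\<lambda>i\<in>{1..n}. h i + \<epsilon> i) \<partial>gaussian_noise n \<sigma>) =
    (\<integral>\<^sup>+ \<epsilon>. ennreal (likelihood_ratio n \<sigma> h \<epsilon>) * F \<epsilon> \<partial>gaussian_noise n \<sigma>)"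
proof -
  have "(\<integral>\<^sup>+ \<epsilon>. F (\<lambda>i\<in>{1..n}. h i + \<epsilon> i) \<partial>gaussian_noise n \<sigma>) =
      (\<integral>\<^sup>+ \<epsilon>. F \<epsilon> \<partial>distr (gaussian_noise n \<sigma>) (vec_space n) (\<lambda>\<epsilon>. \<lambda>i\<in>{1..n}. h i + \<epsilon> i))"
    by (subst nn_integral_distr) auto
  then show ?thesis
    by (simp add: distr_gaussian_noise_shift[OF assms(1)] nn_integral_density)
qed

text \<open>Squaring the ratio for the shift \<open>h\<close> gives, up to a constant factor, the ratio for \<open>2 h\<close>.\<close>

lemma nn_integral_likelihood_ratio_squared:
  assumes "\<sigma> > 0"
  shows "(\<integral>\<^sup>+ \<epsilon>. ennreal ((likelihood_ratio n \<sigma> h \<epsilon>)\<^sup>2) \<partial>gaussian_noise n \<sigma>) =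
    ennreal (exp ((\<Sum>i\<in>{1..n}. (h i)\<^sup>2) / \<sigma>\<^sup>2))"
proof -
  interpret G: prob_space "gaussian_noise n \<sigma>"
    using assms by (rule prob_space_gaussian_noise)
  have sq: "(likelihood_ratio n \<sigma> h \<epsilon>)\<^sup>2 =
      exp ((\<Sum>i\<in>{1..n}. (h i)\<^sup>2) / \<sigma>\<^sup>2) * likelihood_ratio n \<sigma> (\<lambda>i. 2 * h i) \<epsilon>" for \<epsilon>
    unfolding likelihood_ratio_def
    by (simp add: exp_sum[symmetric] exp_add[symmetric] exp_double[symmetric] sum_distrib_left
        sum_divide_distrib sum.distrib[symmetric] diff_divide_distrib algebra_simps power_mult_distrib)
  have "(\<integral>\<^sup>+ \<epsilon>. ennreal ((likelihood_ratio n \<sigma> h \<epsilon>)\<^sup>2) \<partial>gaussian_noise n \<sigma>) =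
    ennreal (exp ((\<Sum>i\<in>{1..n}. (h i)\<^sup>2) / \<sigma>\<^sup>2)) *
      (\<integral>\<^sup>+ \<epsilon>. ennreal (likelihood_ratio n \<sigma> (\<lambda>i. 2 * h i) \<epsilon>) * 1 \<partial>gaussian_noise n \<sigma>)"
    unfolding sq by (subst nn_integral_cmult[symmetric]) (auto simp: ennreal_mult')
  \<comment> \<open>Shifted noise is again a probability measure, so its density integrates to
    1.\<close>
  also have "(\<integral>\<^sup>+ \<epsilon>. ennreal (likelihood_ratio n \<sigma> (\<lambda>i. 2 * h i) \<epsilon>) * 1 \<partial>gaussian_noise n \<sigma>) = 1"
    using G.emeasure_space_1 by (subst nn_integral_gaussian_noise_shift[OF assms, symmetric]) auto
  finally show ?thesis by simp
qed

section \<open>Lower bounds from finitely many hypotheses\<close>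

lemma measurable_observation [measurable]: "observation n \<theta> \<in> measurable (vec_space n) (vec_space n)"
  unfolding observation_def by measurable

text \<open>The events \<open>l j < D\<close> are disjoint under the base measure at \<open>\<eta>\<close>; the inequality
  \<open>W \<le> W\<^sup>2 / N + N / 4\<close> for the likelihood ratio transfers this to the hypotheses.\<close>

lemma sum_risk_separated_hypotheses:
  fixes l :: "'j \<Rightarrow> (nat \<Rightarrow> real) \<Rightarrow> ennreal" and D :: real
  assumes "\<sigma> > 0" and J: "finite J" "J \<noteq> {}" and D: "D \<ge> 0"
    and meas: "\<And>j. j \<in> J \<Longrightarrow> l j \<in> borel_measurable (vec_space n)"
    and sep: "\<And>y j k. y \<in> space (vec_space n) \<Longrightarrow> j \<in> J \<Longrightarrow> k \<in> J \<Longrightarrow> j \<noteq> k \<Longrightarrow>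
        l j y < ennreal D \<Longrightarrow> l k y \<ge> ennreal D"
    and close: "\<And>j. j \<in> J \<Longrightarrow>
        exp ((\<Sum>i\<in>{1..n}. (\<theta> j i - \<eta> i)\<^sup>2) / \<sigma>\<^sup>2) \<le> real (card J) / 4"
  shows "(\<Sum>j\<in>J. \<integral>\<^sup>+ \<epsilon>. l j (observation n (\<theta> j) \<epsilon>) \<partial>gaussian_noise n \<sigma>) \<ge>
    ennreal (real (card J) * D / 2)"
proof -
  interpret G: prob_space "gaussian_noise n \<sigma>"
    using assms by (intro prob_space_gaussian_noise)
  let ?G = "gaussian_noise n \<sigma>"
  define N where "N = real (card J)"
  have "N > 0" using J by (simp add: N_def card_gt_0_iff)
  define A where "A j = {\<epsilon> \<in> space ?G. l j (observation n \<eta> \<epsilon>) < ennreal D}" for j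
  have A_meas [measurable]: "A j \<in> sets (vec_space n)" if "j \<in> J" for j
  proof -
    note meas[OF that, measurable]
    show ?thesis unfolding A_def by simp
  qed
  have obs_space: "observation n \<theta>' \<epsilon> \<in> space (vec_space n)" for \<theta>' \<epsilon>
    by (auto simp: observation_def space_PiM)
  have "disjoint_family_on A J"
    unfolding disjoint_family_on_def A_def using sep[OF obs_space] by (fastforce simp: not_le)
  then have "(\<Sum>j\<in>J. emeasure ?G (A j)) = emeasure ?G (\<Union>j\<in>J. A j)"
    using J A_meas by (intro sum_emeasure) auto
  also have "\<dots> \<le> 1" by (rule G.emeasure_le_1)
  finally have sumA: "(\<Sum>j\<in>J. emeasure ?G (A j)) \<le> 1" .
  have each: "ennreal D \<le> (\<integral>\<^sup>+ \<epsilon>. l j (observation n (\<theta> j) \<epsilon>) \<partial>?G) +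
      ennreal D * (ennreal (1/4) + ennreal (N/4) * emeasure ?G (A j))" if "j \<in> J" for j
  proof -
    note meas[OF that, measurable] A_meas[OF that, measurable]
    define W where "W = likelihood_ratio n \<sigma> (\<lambda>i. \<theta> j i - \<eta> i)"
    have [measurable]: "W \<in> borel_measurable (vec_space n)" unfolding W_def by simp
    \<comment> \<open>Observing under \<open>\<theta> j\<close> is observing under
      \<open>\<eta>\<close> with shifted noise, so the probability of \<open>A j\<close> can be
      moved to the base measure.\<close>
    let ?s = "\<lambda>\<epsilon>. \<lambda>i\<in>{1..n}. (\<theta> j i - \<eta> i) + \<epsilon> i"
    have obs: "observation n (\<theta> j) \<epsilon> = observation n \<eta> (?s \<epsilon>)" for \<epsilon>
      by (auto simp: observation_def fun_eq_iff)
    have "ennreal D = (\<integral>\<^sup>+ \<epsilon>. ennreal D \<partial>?G)"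
      using G.emeasure_space_1 by simp
    also have "\<dots> \<le> (\<integral>\<^sup>+ \<epsilon>. l j (observation n (\<theta> j) \<epsilon>) + ennreal D * indicator (A j) (?s \<epsilon>) \<partial>?G)"
      by (intro nn_integral_mono)
        (auto simp: A_def obs not_less space_PiM split: split_indicator)
    also have "\<dots> = (\<integral>\<^sup>+ \<epsilon>. l j (observation n (\<theta> j) \<epsilon>) \<partial>?G) +
        ennreal D * (\<integral>\<^sup>+ \<epsilon>. indicator (A j) (?s \<epsilon>) \<partial>?G)"
      by (subst nn_integral_add) (auto simp: nn_integral_cmult)
    finally have D_le: "ennreal D \<le> (\<integral>\<^sup>+ \<epsilon>. l j (observation n (\<theta> j) \<epsilon>) \<partial>?G) +
        ennreal D * (\<integral>\<^sup>+ \<epsilon>. indicator (A j) (?s \<epsilon>) \<partial>?G)" .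
    have "(\<integral>\<^sup>+ \<epsilon>. indicator (A j) (?s \<epsilon>) \<partial>?G) = (\<integral>\<^sup>+ \<epsilon>. ennreal (W \<epsilon>) * indicator (A j) \<epsilon> \<partial>?G)"
      unfolding W_def by (rule nn_integral_gaussian_noise_shift) (use assms in auto)
    also have "\<dots> \<le> (\<integral>\<^sup>+ \<epsilon>. ennreal (1/N) * ennreal ((W \<epsilon>)\<^sup>2) + ennreal (N/4) * indicator (A j) \<epsilon> \<partial>?G)"
    proof (rule nn_integral_mono)
      fix \<epsilon>
      have "0 \<le> (W \<epsilon> - N/2)\<^sup>2" by simp
      then have "W \<epsilon> \<le> 1/N * (W \<epsilon>)\<^sup>2 + N/4"
        using \<open>N > 0\<close> by (simp add: field_simps power2_eq_square)
      then show "ennreal (W \<epsilon>) * indicator (A j) \<epsilon> \<le>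
          ennreal (1/N) * ennreal ((W \<epsilon>)\<^sup>2) + ennreal (N/4) * indicator (A j) \<epsilon>"
        using \<open>N > 0\<close> by (auto simp: ennreal_mult'[symmetric] ennreal_plus[symmetric]
            simp del: ennreal_plus split: split_indicator)
    qed
    also have "\<dots> = ennreal (1/N) * (\<integral>\<^sup>+ \<epsilon>. ennreal ((W \<epsilon>)\<^sup>2) \<partial>?G) + ennreal (N/4) * emeasure ?G (A j)"
      by (subst nn_integral_add) (auto simp: nn_integral_cmult)
    also have "\<dots> \<le> ennreal (1/4) + ennreal (N/4) * emeasure ?G (A j)"
    proof -
      have "1/N * exp ((\<Sum>i\<in>{1..n}. (\<theta> j i - \<eta> i)\<^sup>2) / \<sigma>\<^sup>2) \<le> 1/4"
        using close[OF that] \<open>N > 0\<close> by (simp add: N_def field_simps)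
      then show ?thesis
        unfolding W_def nn_integral_likelihood_ratio_squared[OF \<open>\<sigma> > 0\<close>]
        using \<open>N > 0\<close> by (intro add_right_mono) (simp add: ennreal_mult'[symmetric] ennreal_leI)
    qed
    finally have "ennreal D * (\<integral>\<^sup>+ \<epsilon>. indicator (A j) (?s \<epsilon>) \<partial>?G) \<le>
        ennreal D * (ennreal (1/4) + ennreal (N/4) * emeasure ?G (A j))"
      by (rule mult_left_mono) simp
    with D_le show ?thesis by (meson add_left_mono order_trans)
  qed
  have "ennreal (N * D) = (\<Sum>j\<in>J. ennreal D)"
    using D by (simp add: N_def ennreal_mult' ennreal_of_nat_eq_real_of_nat)
  also have "\<dots> \<le> (\<Sum>j\<in>J. (\<integral>\<^sup>+ \<epsilon>. l j (observation n (\<theta> j) \<epsilon>) \<partial>?G) +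
      ennreal D * (ennreal (1/4) + ennreal (N/4) * emeasure ?G (A j)))"
    by (intro sum_mono each)
  also have "\<dots> = (\<Sum>j\<in>J. \<integral>\<^sup>+ \<epsilon>. l j (observation n (\<theta> j) \<epsilon>) \<partial>?G) +
      ennreal D * (ennreal (N/4) + ennreal (N/4) * (\<Sum>j\<in>J. emeasure ?G (A j)))"
  proof -
    have "(\<Sum>j\<in>J. ennreal (1/4)) = ennreal (\<Sum>j\<in>J. 1/4)" by (rule sum_ennreal) simp
    also have "(\<Sum>j\<in>J. 1/4 :: real) = N/4" by (simp add: N_def)
    finally have "(\<Sum>j\<in>J. ennreal (1/4)) = ennreal (N/4)" .
    then show ?thesis by (simp only: sum.distrib sum_distrib_left[symmetric])
  qed
  \<comment> \<open>Of the total \<open>N * D\<close>, the second moments cost one quarter and the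
    disjoint events together at most another.\<close>
  also have "\<dots> \<le> (\<Sum>j\<in>J. \<integral>\<^sup>+ \<epsilon>. l j (observation n (\<theta> j) \<epsilon>) \<partial>?G) +
      ennreal D * (ennreal (N/4) + ennreal (N/4) * 1)"
    by (intro add_mono mult_left_mono sumA) auto
  also have "ennreal D * (ennreal (N/4) + ennreal (N/4) * 1) = ennreal (N * D / 2)"
    using \<open>N > 0\<close> D by (simp add: ennreal_mult'[symmetric] ennreal_plus[symmetric] del: ennreal_plus)
  finally have "ennreal (N * D) \<le>
      (\<Sum>j\<in>J. \<integral>\<^sup>+ \<epsilon>. l j (observation n (\<theta> j) \<epsilon>) \<partial>?G) + ennreal (N * D / 2)" .
  moreover have "ennreal (N * D) = ennreal (N * D / 2) + ennreal (N * D / 2)"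
    using \<open>N > 0\<close> D by (simp add: ennreal_plus[symmetric] del: ennreal_plus)
  ultimately have "ennreal (N * D / 2) + ennreal (N * D / 2) \<le>
      ennreal (N * D / 2) + (\<Sum>j\<in>J. \<integral>\<^sup>+ \<epsilon>. l j (observation n (\<theta> j) \<epsilon>) \<partial>?G)"
    by (simp add: add.commute)
  then show ?thesis by (simp add: N_def ennreal_add_left_cancel_le)
qed

text \<open>Exchanging \<open>j\<close> with \<open>w b\<close> is an involution of the pairs
  \<open>(w, j)\<close>. In terms of the uniform prior: redrawing one coordinate does not change it,
  so a bound for one block can be averaged over the choices in all others.\<close>

lemma sum_PiE_update:
  fixes X :: "('b \<Rightarrow> 'j) \<Rightarrow> 'a::comm_semiring_1"
  assumes "b \<in> B"
  shows "(\<Sum>w\<in>B \<rightarrow>\<^sub>E J. \<Sum>j\<in>J. X (w(b := j))) = of_nat (card J) * (\<Sum>w\<in>B \<rightarrow>\<^sub>E J. X w)"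
proof -
  have "(\<Sum>w\<in>B \<rightarrow>\<^sub>E J. \<Sum>j\<in>J. X (w(b := j))) =
      (\<Sum>(w, j)\<in>(B \<rightarrow>\<^sub>E J) \<times> J. X (w(b := j)))"
    by (simp add: sum.cartesian_product)
  also have "\<dots> = (\<Sum>(w, j)\<in>(B \<rightarrow>\<^sub>E J) \<times> J. X w)"
    using assms
    by (intro sum.reindex_bij_witness[where i = "\<lambda>(w, j). (w(b := j), w b)"
          and j = "\<lambda>(w, j). (w(b := j), w b)"]) (auto simp: PiE_iff extensional_def)
  also have "\<dots> = of_nat (card J) * (\<Sum>w\<in>B \<rightarrow>\<^sub>E J. X w)"
    by (simp add: sum.cartesian_product[symmetric] sum_distrib_left)
  finally show ?thesis .
qed

text \<open>The supremum is at least the average over all \<open>w\<close>, and the squared loss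
  splits over disjoint blocks. For one block the choices elsewhere are frozen; they only move the
  base point, which is arbitrary in the one-block bound.\<close>

lemma minimax_risk_product_lower_bound:
  fixes v :: "'b \<Rightarrow> 'j \<Rightarrow> nat \<Rightarrow> real" and D :: real
  assumes "\<sigma> > 0" and B: "finite B" and J: "finite J" "J \<noteq> {}" and D: "D \<ge> 0"
    and I: "\<And>b. b \<in> B \<Longrightarrow> I b \<subseteq> {1..n}" "disjoint_family_on I B"
    and supp: "\<And>b j i. b \<in> B \<Longrightarrow> j \<in> J \<Longrightarrow> i \<notin> I b \<Longrightarrow> v b j i = 0"
    and close: "\<And>b j. b \<in> B \<Longrightarrow> j \<in> J \<Longrightarrow>
        exp ((\<Sum>i\<in>I b. (v b j i)\<^sup>2) / \<sigma>\<^sup>2) \<le> real (card J) / 4"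
    and sep: "\<And>b j k. b \<in> B \<Longrightarrow> j \<in> J \<Longrightarrow> k \<in> J \<Longrightarrow> j \<noteq> k \<Longrightarrow>
        (\<Sum>i\<in>I b. (v b j i - v b k i)\<^sup>2) \<ge> 4 * D"
    and mem: "\<And>w. w \<in> B \<rightarrow>\<^sub>E J \<Longrightarrow> (\<lambda>i\<in>{1..n}. \<Sum>b\<in>B. v b (w b) i) \<in> \<Theta>"
  shows "minimax_risk n \<sigma> \<Theta> \<ge> ennreal (real (card B) * D / 2)"
  unfolding minimax_risk_def
proof (rule INF_greatest)
  fix T assume T [measurable]: "T \<in> measurable (vec_space n) (vec_space n)"
  let ?G = "gaussian_noise n \<sigma>"
  define S where "S = (SUP \<theta>\<in>\<Theta>. risk n \<sigma> T \<theta>)"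
  define \<theta> where "\<theta> w = (\<lambda>i\<in>{1..n}. \<Sum>b\<in>B. v b (w b) i)" for w
  define l where "l b j y = ennreal (\<Sum>i\<in>I b. (T y i - v b j i)\<^sup>2)" for b j y
  define X where "X b w = (\<integral>\<^sup>+ \<epsilon>. l b (w b) (observation n (\<theta> w) \<epsilon>) \<partial>?G)" for b w
  let ?\<Omega> = "B \<rightarrow>\<^sub>E J"
  have finI: "finite (I b)" if "b \<in> B" for b
    using I(1)[OF that] by (rule finite_subset) simp
  have fin: "finite ?\<Omega>" "card ?\<Omega> > 0"
    using B J by (auto intro!: finite_PiE simp: card_PiE card_gt_0_iff)
  have T_comp [measurable]: "(\<lambda>y. T y i) \<in> borel_measurable (vec_space n)" if "i \<in> {1..n}" for i
    using measurable_compose[OF T measurable_component_singleton[OF that]] .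
  have l_meas: "l b j \<in> borel_measurable (vec_space n)" if "b \<in> B" for b j
  proof -
    have "(\<lambda>y. (T y i - v b j i)\<^sup>2) \<in> borel_measurable (vec_space n)" if "i \<in> I b" for i
      using T_comp[of i] I(1)[OF \<open>b \<in> B\<close>] that by (intro borel_measurable_power borel_measurable_diff) auto
    then show ?thesis
      unfolding l_def by (intro measurable_compose[OF _ measurable_ennreal] borel_measurable_sum)
  qed
  have block: "(\<Sum>c\<in>B. v c (w c) i) = v b (w b) i" if "b \<in> B" "i \<in> I b" "w \<in> ?\<Omega>" for b i w
  proof -
    have "v c (w c) i = 0" if "c \<in> B - {b}" for c
      using that \<open>b \<in> B\<close> \<open>i \<in> I b\<close> \<open>w \<in> ?\<Omega>\<close> I(2)
      by (intro supp) (auto simp: disjoint_family_on_def)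
    then show ?thesis
      using B \<open>b \<in> B\<close> by (simp add: sum.remove[of B b])
  qed
  have risk_ge: "risk n \<sigma> T (\<theta> w) \<ge> (\<Sum>b\<in>B. X b w)" if w: "w \<in> ?\<Omega>" for w
  proof -
    have "(\<Sum>b\<in>B. X b w) = (\<integral>\<^sup>+ \<epsilon>. (\<Sum>b\<in>B. l b (w b) (observation n (\<theta> w) \<epsilon>)) \<partial>?G)"
      unfolding X_def using l_meas[THEN measurable_compose[OF measurable_observation]]
      by (subst nn_integral_sum) auto
    also have "\<dots> \<le> risk n \<sigma> T (\<theta> w)"
      unfolding risk_def
    proof (rule nn_integral_mono)
      fix \<epsilon>
      let ?y = "observation n (\<theta> w) \<epsilon>"
      have "(\<Sum>b\<in>B. \<Sum>i\<in>I b. (T ?y i - v b (w b) i)\<^sup>2) = (\<Sum>b\<in>B. \<Sum>i\<in>I b. (T ?y i - \<theta> w i)\<^sup>2)"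
        using I(1) block[OF _ _ w] by (intro sum.cong refl) (auto simp: \<theta>_def subset_iff)
      also have "\<dots> = (\<Sum>i\<in>(\<Union>b\<in>B. I b). (T ?y i - \<theta> w i)\<^sup>2)"
        using B finI I(2) by (subst sum.UNION_disjoint_family) auto
      also have "\<dots> \<le> (\<Sum>i\<in>{1..n}. (T ?y i - \<theta> w i)\<^sup>2)"
        using I(1) by (intro sum_mono2) auto
      also have "\<dots> = (L2_set (\<lambda>i. T ?y i - \<theta> w i) {1..n})\<^sup>2"
        by (simp add: L2_set_def sum_nonneg)
      finally show "(\<Sum>b\<in>B. l b (w b) ?y) \<le> ennreal ((L2_set (\<lambda>i. T ?y i - \<theta> w i) {1..n})\<^sup>2)"
        unfolding l_def by (subst sum_ennreal) (auto intro!: sum_nonneg ennreal_leI)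
    qed
    finally show ?thesis .
  qed
  have X_block: "(\<Sum>j\<in>J. X b (w(b := j))) \<ge> ennreal (real (card J) * D / 2)"
    if b: "b \<in> B" and w: "w \<in> ?\<Omega>" for b w
  proof -
    \<comment> \<open>The contribution of the other blocks, the same for every choice
      \<open>j\<close> in block \<open>b\<close>, serves as base point.\<close>
    define \<eta> where "\<eta> i = (\<Sum>c\<in>B - {b}. v c (w c) i)" for i
    have diff: "\<theta> (w(b := j)) i - \<eta> i = v b j i" if "i \<in> {1..n}" for i j
      using B b that by (simp add: \<theta>_def \<eta>_def sum.remove[of B b])
    have "ennreal (real (card J) * D / 2) \<le>
        (\<Sum>j\<in>J. \<integral>\<^sup>+ \<epsilon>. l b j (observation n (\<theta> (w(b := j))) \<epsilon>) \<partial>?G)"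
    proof (rule sum_risk_separated_hypotheses[where \<eta> = \<eta>])
      fix j assume j: "j \<in> J"
      have "(\<Sum>i\<in>{1..n}. (\<theta> (w(b := j)) i - \<eta> i)\<^sup>2) = (\<Sum>i\<in>I b. (v b j i)\<^sup>2)"
        using I(1)[OF b] supp[OF b j] diff by (intro sum.mono_neutral_cong_right) auto
      then show "exp ((\<Sum>i\<in>{1..n}. (\<theta> (w(b := j)) i - \<eta> i)\<^sup>2) / \<sigma>\<^sup>2) \<le> real (card J) / 4"
        using close[OF b j] by simp
    next
      fix y j k
      assume jk: "j \<in> J" "k \<in> J" "j \<noteq> k" and less: "l b j y < ennreal D"
      \<comment> \<open>The factor 4 is the price of bounding \<open>(x - y)\<^sup>2\<close> by
        \<open>2 * x\<^sup>2 + 2 * y\<^sup>2\<close>: if one loss is below \<open>D\<close>, the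
        other exceeds \<open>D\<close>.\<close>
      have "4 * D \<le> (\<Sum>i\<in>I b. (v b j i - v b k i)\<^sup>2)"
        using sep[OF b jk] .
      also have "\<dots> \<le> (\<Sum>i\<in>I b. 2 * (T y i - v b j i)\<^sup>2 + 2 * (T y i - v b k i)\<^sup>2)"
      proof (rule sum_mono)
        fix i
        have "0 \<le> ((T y i - v b j i) + (T y i - v b k i))\<^sup>2" by simp
        then show "(v b j i - v b k i)\<^sup>2 \<le> 2 * (T y i - v b j i)\<^sup>2 + 2 * (T y i - v b k i)\<^sup>2"
          by (simp add: power2_eq_square algebra_simps)
      qed
      also have "\<dots> = 2 * (\<Sum>i\<in>I b. (T y i - v b j i)\<^sup>2) + 2 * (\<Sum>i\<in>I b. (T y i - v b k i)\<^sup>2)"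
        by (simp add: sum.distrib sum_distrib_left)
      also have "(\<Sum>i\<in>I b. (T y i - v b j i)\<^sup>2) < D"
        using less by (auto simp: l_def ennreal_less_iff sum_nonneg)
      finally show "l b k y \<ge> ennreal D"
        unfolding l_def by (intro ennreal_leI) linarith
    qed (use assms l_meas[OF b] in auto)
    then show ?thesis by (simp add: X_def)
  qed
  have X_sum: "(\<Sum>w\<in>?\<Omega>. X b w) \<ge> of_nat (card ?\<Omega>) * ennreal (D / 2)" if b: "b \<in> B" for b
  proof -
    have "of_nat (card J) * (of_nat (card ?\<Omega>) * ennreal (D / 2)) =
        (\<Sum>w\<in>?\<Omega>. ennreal (real (card J) * D / 2))"
      using D by (simp add: ennreal_of_nat_eq_real_of_nat ennreal_mult'[symmetric] mult_ac)
    also have "\<dots> \<le> (\<Sum>w\<in>?\<Omega>. \<Sum>j\<in>J. X b (w(b := j)))"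
      by (intro sum_mono X_block b)
    also have "\<dots> = of_nat (card J) * (\<Sum>w\<in>?\<Omega>. X b w)"
      by (rule sum_PiE_update[OF b])
    finally show ?thesis
      using J by (subst (asm) ennreal_mult_le_mult_iff) (auto simp: card_gt_0_iff)
  qed
  have "of_nat (card ?\<Omega>) * ennreal (real (card B) * D / 2) = (\<Sum>b\<in>B. of_nat (card ?\<Omega>) * ennreal (D / 2))"
    using D by (simp add: ennreal_of_nat_eq_real_of_nat ennreal_mult'[symmetric] mult_ac)
  also have "\<dots> \<le> (\<Sum>b\<in>B. \<Sum>w\<in>?\<Omega>. X b w)"
    by (intro sum_mono X_sum)
  also have "\<dots> = (\<Sum>w\<in>?\<Omega>. \<Sum>b\<in>B. X b w)"
    by (rule sum.swap)
  also have "\<dots> \<le> (\<Sum>w\<in>?\<Omega>. S)"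
    unfolding S_def using mem[folded \<theta>_def]
    by (intro sum_mono order_trans[OF risk_ge] SUP_upper) simp_all
  also have "\<dots> = of_nat (card ?\<Omega>) * S" by simp
  finally show "ennreal (real (card B) * D / 2) \<le> (SUP \<theta>\<in>\<Theta>. risk n \<sigma> T \<theta>)"
    using fin unfolding S_def by (subst (asm) ennreal_mult_le_mult_iff) auto
qed

section \<open>Splines with prescribed knots\<close>

text \<open>\<open>deriv\<close> is total and depends only on the germ of the function, so equality
  on an open set survives every iteration.\<close>

lemma higher_deriv_eq_poly:
  fixes f :: "real \<Rightarrow> real"
  assumes "open S" "\<And>x. x \<in> S \<Longrightarrow> f x = poly p x" "x \<in> S"
  shows "(deriv ^^ l) f x = poly ((pderiv ^^ l) p) x"
  using assms(3)
proof (induction l arbitrary: x)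
  case (Suc l)
  have "eventually (\<lambda>y. (deriv ^^ l) f y = poly ((pderiv ^^ l) p) y) (nhds x)"
    using Suc assms(1) by (auto simp: eventually_nhds)
  then have "deriv ((deriv ^^ l) f) x = deriv (poly ((pderiv ^^ l) p)) x"
    by (rule deriv_cong_ev) simp
  then show ?case
    by (simp add: DERIV_imp_deriv[OF poly_DERIV])
qed (use assms in auto)

text \<open>Each differentiation lowers the multiplicity of a root by at most one.\<close>

lemma higher_pderiv_root:
  fixes p :: "real poly"
  assumes "[:- a, 1:] ^ e dvd p" "l < e"
  shows "poly ((pderiv ^^ l) p) a = 0"
proof -
  have dvd: "[:- a, 1:] ^ m dvd (pderiv ^^ l) p" if "m + l = e" for m l
    using that
  proof (induction l arbitrary: m)
    case (Suc l)
    have "[:- a, 1:] ^ Suc m dvd (pderiv ^^ l) p"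
      by (intro Suc.IH) (use Suc.prems in simp)
    then obtain r where "(pderiv ^^ l) p = [:- a, 1:] ^ Suc m * r" by (elim dvdE)
    moreover have "pderiv (A ^ Suc m * r) = A ^ m * (A * pderiv r + r * smult (1 + of_nat m) (pderiv A))"
      for A :: "real poly"
      by (simp only: pderiv_mult pderiv_power_Suc) (simp add: algebra_simps)
    ultimately have "(pderiv ^^ Suc l) p =
        [:- a, 1:] ^ m * ([:- a, 1:] * pderiv r + r * smult (1 + of_nat m) (pderiv [:- a, 1:]))"
      by (simp only: funpow.simps comp_apply)
    then show ?case by (metis dvd_triv_left)
  qed (use assms in auto)
  have "[:- a, 1:] ^ (e - l) dvd (pderiv ^^ l) p"
    using assms by (intro dvd) auto
  then have "[:- a, 1:] dvd (pderiv ^^ l) p"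
    using \<open>l < e\<close> by (meson dvd_power dvd_trans zero_less_diff)
  then show ?thesis by (simp add: poly_eq_0_iff_dvd)
qed

text \<open>To use fewer than \<open>k - 1\<close> knots, place the remaining ones at \<open>n\<close>.\<close>

lemma spline_classI:
  fixes q :: "nat \<Rightarrow> real poly"
  assumes n: "n > 0" and m: "mono m" "m 0 = 0" "m k = n"
    and gap: "\<And>i. i \<in> {1..k} \<Longrightarrow> m (i - 1) < m i \<Longrightarrow> m (i - 1) + d + 1 \<le> m i"
    and deg: "\<And>i. i \<in> {1..k-1} \<Longrightarrow> degree (q i) \<le> d"
    and dvd: "\<And>i. i \<in> {1..k-1} \<Longrightarrow> [:- (real (m i) / real n), 1:] ^ nat (d0 + 1) dvd q i"
  shows "(\<lambda>x. \<Sum>i\<in>{1..k-1}. if real (m i) / real n < x then poly (q i) x else 0) \<in> spline_class n d d0 k"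
    (is "?f \<in> _")
proof -
  have piece: "\<exists>p::real poly. degree p \<le> d \<and>
      (\<forall>x\<in>{real (m (i - 1)) / real n <.. real (m i) / real n}. ?f x = poly p x)" if i: "i \<in> {1..k}" for i
  proof (intro exI conjI ballI)
    let ?J = "{j \<in> {1..k-1}. j < i}"
    show "degree (\<Sum>j\<in>?J. q j) \<le> d"
      using deg by (intro degree_sum_le) auto
    fix x assume x: "x \<in> {real (m (i - 1)) / real n <.. real (m i) / real n}"
    \<comment> \<open>The knots are sorted and the truncation is strict, so a left-open piece sees
      exactly the terms with smaller index.\<close>
    have "real (m j) / real n < x \<longleftrightarrow> j < i" for j
    proof
      assume "j < i"
      then have "real (m j) \<le> real (m (i - 1))" using monoD[OF m(1), of j "i - 1"] by simp
      then have "real (m j) / real n \<le> real (m (i - 1)) / real n" by (rule divide_right_mono) simp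
      then show "real (m j) / real n < x" using x by simp
    next
      assume *: "real (m j) / real n < x"
      show "j < i"
      proof (rule ccontr)
        assume "\<not> j < i"
        then have "real (m i) \<le> real (m j)" using monoD[OF m(1), of i j] by simp
        then have "real (m i) / real n \<le> real (m j) / real n" by (rule divide_right_mono) simp
        then show False using x * by simp
      qed
    qed
    then show "?f x = poly (\<Sum>j\<in>?J. q j) x"
      unfolding poly_sum by (subst sum.inter_filter) simp_all
  qed
  \<comment> \<open>Derivatives are computed on cells between adjacent lattice points rather than
    between knots, so coincident knots need no separate treatment.\<close>
  have near: "(deriv ^^ l) ?f x = poly ((pderiv ^^ l) (\<Sum>j | j \<in> {1..k-1} \<and> m j \<le> s. q j)) x"
    if "x \<in> {real s / real n <..< real (s + 1) / real n}" for l s x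
  proof (rule higher_deriv_eq_poly[OF _ _ that])
    fix x assume x: "x \<in> {real s / real n <..< real (s + 1) / real n}"
    have "real (m j) / real n < x \<longleftrightarrow> m j \<le> s" for j
    proof
      assume "m j \<le> s"
      then have "real (m j) / real n \<le> real s / real n" by (intro divide_right_mono) auto
      then show "real (m j) / real n < x" using x by simp
    next
      assume "real (m j) / real n < x"
      also have "x < real (s + 1) / real n" using x by simp
      finally have "real (m j) < real (s + 1)" using n by (simp add: divide_less_cancel)
      then show "m j \<le> s" by linarith
    qed
    then show "?f x = poly (\<Sum>j | j \<in> {1..k-1} \<and> m j \<le> s. q j) x"
      unfolding poly_sum by (subst sum.inter_filter) simp_all
  qed simp
  have smooth: "\<exists>L. (((deriv ^^ l) ?f) \<longlongrightarrow> L) (at_left (real (m i) / real n)) \<and>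
      (((deriv ^^ l) ?f) \<longlongrightarrow> L) (at_right (real (m i) / real n))"
    if i: "i \<in> {1..k-1}" "0 < m i" and l: "int l \<le> d0" for i l
  proof (intro exI conjI)
    let ?t = "real (m i) / real n"
    let ?P = "\<lambda>s. (pderiv ^^ l) (\<Sum>j | j \<in> {1..k-1} \<and> m j \<le> s. q j)"
    \<comment> \<open>Crossing this point switches on only the terms whose knot equals
      \<open>m i\<close>, and they have a root of order at least \<open>nat (d0 + 1)\<close>
      there.\<close>
    have "poly (\<Sum>j | j \<in> {1..k-1} \<and> m j \<le> m i. (pderiv ^^ l) (q j)) ?t =
        poly (\<Sum>j | j \<in> {1..k-1} \<and> m j \<le> m i - 1. (pderiv ^^ l) (q j)) ?t"
      unfolding poly_sum
    proof (rule sum.mono_neutral_right, goal_cases)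
      case 3
      show ?case
      proof
        fix j assume "j \<in> {j \<in> {1..k-1}. m j \<le> m i} - {j \<in> {1..k-1}. m j \<le> m i - 1}"
        then have "m j = m i" "j \<in> {1..k-1}" by auto
        then show "poly ((pderiv ^^ l) (q j)) ?t = 0"
          using dvd[of j] l by (intro higher_pderiv_root[where e = "nat (d0 + 1)"]) auto
      qed
    qed auto
    then have eq: "poly (?P (m i)) ?t = poly (?P (m i - 1)) ?t"
      by (simp add: higher_pderiv_sum)
    have "(poly (?P (m i - 1)) \<longlongrightarrow> poly (?P (m i - 1)) ?t) (at_left ?t)"
      by (intro tendsto_intros)
    moreover have "eventually (\<lambda>x. (deriv ^^ l) ?f x = poly (?P (m i - 1)) x) (at_left ?t)"
    proof (rule eventually_at_leftI)
      show "real (m i - 1) / real n < ?t" using i n by (intro divide_strict_right_mono) auto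
      show "\<And>x. x \<in> {real (m i - 1) / real n<..<?t} \<Longrightarrow> (deriv ^^ l) ?f x = poly (?P (m i - 1)) x"
        using near[of _ "m i - 1"] i by simp
    qed
    ultimately show "(((deriv ^^ l) ?f) \<longlongrightarrow> poly (?P (m i - 1)) ?t) (at_left ?t)"
      by (simp add: tendsto_cong)
    have "(poly (?P (m i)) \<longlongrightarrow> poly (?P (m i - 1)) ?t) (at_right ?t)"
      unfolding eq[symmetric] by (intro tendsto_intros)
    moreover have "eventually (\<lambda>x. (deriv ^^ l) ?f x = poly (?P (m i)) x) (at_right ?t)"
    proof (rule eventually_at_rightI)
      show "?t < real (m i + 1) / real n" using i n by (intro divide_strict_right_mono) auto
      show "\<And>x. x \<in> {?t<..<real (m i + 1) / real n} \<Longrightarrow> (deriv ^^ l) ?f x = poly (?P (m i)) x"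
        using near[of _ "m i"] i by simp
    qed
    ultimately show "(((deriv ^^ l) ?f) \<longlongrightarrow> poly (?P (m i - 1)) ?t) (at_right ?t)"
      by (simp add: tendsto_cong)
  qed
  show ?thesis
    unfolding spline_class_def mem_Collect_eq
  proof (intro exI[of _ m] conjI ballI impI allI)
    fix i assume "i \<in> {1..k}" "m (i - 1) < m i"
    then show "m i - m (i - 1) \<ge> d + 1" using gap[of i] by linarith
  qed (use m piece smooth in \<open>auto intro: monoD\<close>)
qed

section \<open>Splines of compact support on the lattice\<close>

lemma pcompose_power: "pcompose (p ^ m) q = pcompose p q ^ m" for p q :: "'a::comm_semiring_1 poly"
  by (induction m) (simp_all add: pcompose_mult pcompose_1)

text \<open>Gaussian elimination on the top coefficient: a member where it is nonzero clears it from
  the others, which leaves one polynomial and one dimension fewer. Equal polynomials with different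
  indices count separately.\<close>

lemma exists_polynomial_linear_relation:
  fixes p :: "'i \<Rightarrow> 'a::field poly"
  assumes "finite I" "card I > m" "\<And>i e. i \<in> I \<Longrightarrow> e \<ge> m \<Longrightarrow> coeff (p i) e = 0"
  shows "\<exists>c. (\<exists>i\<in>I. c i \<noteq> 0) \<and> (\<Sum>i\<in>I. smult (c i) (p i)) = 0"
  using assms
proof (induction m arbitrary: I p)
  case 0
  then have "p i = 0" if "i \<in> I" for i
    using that by (intro poly_eqI) simp
  moreover have "I \<noteq> {}" using 0 by auto
  ultimately show ?case by (intro exI[of _ "\<lambda>_. 1"]) auto
next
  case (Suc m)
  show ?case
  proof (cases "\<forall>i\<in>I. coeff (p i) m = 0")
    case True
    have "coeff (p i) e = 0" if "i \<in> I" "m \<le> e" for i e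
      using that True Suc.prems(3)[of i e] by (cases "e = m") auto
    then show ?thesis using Suc.prems by (intro Suc.IH) auto
  next
    case False
    then obtain k where k: "k \<in> I" "coeff (p k) m \<noteq> 0" by auto
    define a where "a i = coeff (p i) m / coeff (p k) m" for i
    have "\<exists>c. (\<exists>i\<in>I - {k}. c i \<noteq> 0) \<and> (\<Sum>i\<in>I - {k}. smult (c i) (p i - smult (a i) (p k))) = 0"
    proof (rule Suc.IH)
      fix i e assume "i \<in> I - {k}" "m \<le> e"
      then show "coeff (p i - smult (a i) (p k)) e = 0"
        using k Suc.prems(3)[of i e] Suc.prems(3)[of k e] by (cases "e = m") (auto simp: a_def)
    qed (use k Suc.prems in auto)
    then obtain c where c: "\<exists>i\<in>I - {k}. c i \<noteq> 0"
        "(\<Sum>i\<in>I - {k}. smult (c i) (p i - smult (a i) (p k))) = 0" by blast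
    define c' where "c' = c(k := - (\<Sum>i\<in>I - {k}. c i * a i))"
    have "(\<Sum>i\<in>I. smult (c' i) (p i)) =
        (\<Sum>i\<in>I - {k}. smult (c i) (p i)) - smult (\<Sum>i\<in>I - {k}. c i * a i) (p k)"
      using Suc.prems k by (simp add: c'_def sum.remove[of I k])
    also have "\<dots> = (\<Sum>i\<in>I - {k}. smult (c i) (p i - smult (a i) (p k)))"
      by (simp add: smult_diff_right sum_subtractf smult_sum)
    finally show ?thesis using c by (intro exI[of _ c']) (auto simp: c'_def)
  qed
qed

text \<open>Stated in lattice units, with knots at the first \<open>K\<close> multiples of
  \<open>D\<close>. The strict inequality matches the left-open pieces of
  \<open>spline_class\<close>.\<close>

definition truncated_sum :: "nat \<Rightarrow> nat \<Rightarrow> (nat \<Rightarrow> real poly) \<Rightarrow> real \<Rightarrow> real" where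
  "truncated_sum K D q x = (\<Sum>r<K. if real (r * D) < x then poly (q r) x else 0)"

lemma truncated_sum_left: "x \<le> 0 \<Longrightarrow> truncated_sum K D q x = 0"
  unfolding truncated_sum_def
proof (intro sum.neutral ballI)
  fix r assume "x \<le> 0"
  then have "\<not> real (r * D) < x" by (meson not_less of_nat_0_le_iff order_trans)
  then show "(if real (r * D) < x then poly (q r) x else 0) = 0" by simp
qed

text \<open>Past the last knot all pieces are active and add up to the zero polynomial.\<close>

lemma truncated_sum_right:
  assumes "(\<Sum>r<K. q r) = 0" "x > real ((K - 1) * D)"
  shows "truncated_sum K D q x = 0"
proof -
  have "real (r * D) < x" if "r < K" for r
  proof -
    have "r * D \<le> (K - 1) * D" using that by (intro mult_right_mono) auto
    then show ?thesis using assms(2) by linarith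
  qed
  then have "truncated_sum K D q x = (\<Sum>r<K. poly (q r) x)"
    unfolding truncated_sum_def by (intro sum.cong) auto
  then show ?thesis using assms(1) by (simp add: poly_sum[symmetric])
qed

text \<open>There are \<open>K (d + 1 - e)\<close> shifted powers \<open>(x - r D)\<^sup>j\<close> with \<open>r < K\<close> and \<open>e \<le> j \<le> d\<close> in a
  space of dimension \<open>d + 1\<close>; a linear relation between them, truncated at the knots, is the
  spline of compact support. It does not vanish on the integers because a nonzero piece of degree
  \<open>d\<close> meets \<open>D \<ge> d + 1\<close> of them.\<close>

lemma exists_compactly_supported_spline:
  assumes "e \<le> d" "K * (d + 1 - e) > d + 1" "D \<ge> d + 1"
  obtains q :: "nat \<Rightarrow> real poly" where
    "\<And>r. degree (q r) \<le> d" "\<And>r. [:- real (r * D), 1:] ^ e dvd q r" "(\<Sum>r<K. q r) = 0"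
    "(\<Sum>u\<in>{1..(K - 1) * D}. (truncated_sum K D q (real u))\<^sup>2) = 1"
proof -
  define X where "X r = [:- real (r * D), 1:]" for r
  define I where "I = {..<K} \<times> {..d - e}"
  have "\<exists>c. (\<exists>i\<in>I. c i \<noteq> 0) \<and> (\<Sum>i\<in>I. smult (c i) (X (fst i) ^ (e + snd i))) = 0"
  proof (rule exists_polynomial_linear_relation)
    have "card I = K * (d + 1 - e)" using assms(1) by (simp add: I_def One_nat_def Suc_diff_le)
    then show "card I > d + 1" using assms(2) by simp
    fix i j assume "i \<in> I" "d + 1 \<le> j"
    then show "coeff (X (fst i) ^ (e + snd i)) j = 0"
      using assms(1) by (intro coeff_eq_0) (auto simp: I_def X_def degree_linear_power)
  qed (simp add: I_def)
  then obtain c where c: "\<exists>i\<in>I. c i \<noteq> 0" "(\<Sum>i\<in>I. smult (c i) (X (fst i) ^ (e + snd i))) = 0"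
    by blast
  define q where "q r = (\<Sum>j\<le>d - e. smult (c (r, j)) (X r ^ (e + j)))" for r
  have q_deg: "degree (q r) \<le> d" for r
    unfolding q_def using assms(1)
    by (intro degree_sum_le) (auto intro!: order_trans[OF degree_smult_le] simp: X_def degree_linear_power)
  have q_dvd: "X r ^ e dvd q r" for r
    unfolding q_def by (intro dvd_sum dvd_smult) (simp add: power_add)
  have q_sum: "(\<Sum>r<K. q r) = 0"
    using c(2) unfolding q_def I_def by (simp add: sum.cartesian_product split_def)
  have "\<exists>r. r < K \<and> q r \<noteq> 0"
  proof -
    obtain r j where rj: "r < K" "j \<le> d - e" "c (r, j) \<noteq> 0" using c(1) by (auto simp: I_def)
    \<comment> \<open>Substituting \<open>X r\<close>, which has degree 1, into a nonzero polynomial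
      cannot give zero; so one nonzero coefficient makes \<open>q r\<close> nonzero.\<close>
    define P where "P = (\<Sum>j\<le>d - e. monom (c (r, j)) (e + j))"
    have "coeff P (e + j) = c (r, j)"
      using rj(2) by (simp add: P_def coeff_sum)
    then have "P \<noteq> 0" using rj(3) by auto
    moreover have "q r = pcompose P (X r)"
      unfolding q_def P_def pcompose_sum by (intro sum.cong refl) (simp add: monom_altdef pcompose_smult pcompose_power pcompose_pCons)
    ultimately have "q r \<noteq> 0" by (simp add: pcompose_eq_0_iff X_def)
    then show ?thesis using rj by blast
  qed
  \<comment> \<open>The first nonzero \<open>q r\<close> is alone up to the next knot. It is not the
    last one, because the \<open>q r\<close> add up to zero.\<close>
  then have "\<exists>r. (r < K \<and> q r \<noteq> 0) \<and> (\<forall>s<r. \<not> (s < K \<and> q s \<noteq> 0))"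
    by (rule exists_least_iff[THEN iffD1])
  then obtain r0 where r0: "r0 < K" "q r0 \<noteq> 0" "\<And>r. r < r0 \<Longrightarrow> q r = 0"
    by (meson order_less_trans)
  have "r0 \<noteq> K - 1"
  proof
    assume "r0 = K - 1"
    then have "q r = 0" if "r < K" "r \<noteq> r0" for r
      using that by (intro r0(3)) linarith
    then have "(\<Sum>r<K. q r) = q r0"
      using r0(1) by (subst sum.remove[of _ r0]) auto
    then show False using q_sum r0 by simp
  qed
  then have "r0 < K - 1" using r0 by simp
  have val: "truncated_sum K D q (real u) = poly (q r0) (real u)" if "u \<in> {r0 * D + 1..r0 * D + D}" for u
  proof -
    have "(if real (r * D) < real u then poly (q r) (real u) else 0) =
        (if r = r0 then poly (q r0) (real u) else 0)" for r
    proof (cases "r > r0")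
      case True
      then have "(r0 + 1) * D \<le> r * D" by (intro mult_right_mono) auto
      then have "\<not> real (r * D) < real u"
        using that by (simp add: not_less distrib_right del: of_nat_mult)
      then show ?thesis using True by simp
    qed (use r0(3)[of r] that in \<open>cases "r = r0"; simp del: of_nat_mult\<close>)
    then show ?thesis using r0(1) by (simp add: truncated_sum_def del: of_nat_mult)
  qed
  define s where "s = (\<Sum>u\<in>{1..(K - 1) * D}. (truncated_sum K D q (real u))\<^sup>2)"
  have "s \<noteq> 0"
  proof
    assume "s = 0"
    then have zero: "truncated_sum K D q (real u) = 0" if "u \<in> {1..(K - 1) * D}" for u
      using that unfolding s_def by (subst (asm) sum_nonneg_eq_0_iff) auto
    have "(r0 + 1) * D \<le> (K - 1) * D" using \<open>r0 < K - 1\<close> by (intro mult_right_mono) auto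
    then have sub: "real ` {r0 * D + 1..r0 * D + D} \<subseteq> {x. poly (q r0) x = 0}"
    proof (intro image_subsetI CollectI)
      fix u assume u: "u \<in> {r0 * D + 1..r0 * D + D}"
      have "r0 * D + D \<le> (K - 1) * D"
        using \<open>(r0 + 1) * D \<le> (K - 1) * D\<close> by (simp only: distrib_right mult_1)
      then show "poly (q r0) (real u) = 0"
        using zero[of u] val[OF u] u by auto
    qed
    have "D = card (real ` {r0 * D + 1..r0 * D + D})"
      by (subst card_image) auto
    also have "\<dots> \<le> card {x. poly (q r0) x = 0}"
      using sub by (rule card_mono[OF poly_roots_finite[OF r0(2)]])
    also have "\<dots> \<le> degree (q r0)" using r0(2) by (rule card_poly_roots_bound)
    also have "\<dots> \<le> d" by (rule q_deg)
    finally show False using assms(3) by simp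
  qed
  moreover have "s \<ge> 0" unfolding s_def by (intro sum_nonneg) simp
  ultimately have "s > 0" by simp
  define q' where "q' r = smult (1 / sqrt s) (q r)" for r
  have "truncated_sum K D q' x = truncated_sum K D q x / sqrt s" for x
    unfolding truncated_sum_def q'_def sum_divide_distrib by (intro sum.cong) auto
  then have "(\<Sum>u\<in>{1..(K - 1) * D}. (truncated_sum K D q' (real u))\<^sup>2) = s / s"
    using \<open>s > 0\<close> by (simp add: power_divide sum_divide_distrib[symmetric] s_def[symmetric])
  moreover have "(\<Sum>r<K. q' r) = smult (1 / sqrt s) (\<Sum>r<K. q r)"
    unfolding q'_def by (intro poly_eqI) (simp add: coeff_sum sum_distrib_left)
  ultimately show ?thesis
    using \<open>s > 0\<close> q_deg q_dvd q_sum
    by (intro that[of q']) (auto simp: q'_def X_def intro: dvd_smult)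
qed

section \<open>One knot\<close>

lemma spline_vectorsI:
  assumes "f \<in> spline_class n d d0 k" "\<And>i. i \<in> {1..n} \<Longrightarrow> f (real i / real n) = g i"
  shows "(\<lambda>i\<in>{1..n}. g i) \<in> spline_vectors n d d0 k"
  using assms unfolding spline_vectors_def by (auto intro!: bexI[of _ f])

text \<open>Scaled to unit Euclidean norm. The \<open>d\<close>-th power meets the matching
  conditions for every \<open>d0 \<le> d - 1\<close>, so one family serves all smoothness
  orders.\<close>

definition truncated_power :: "nat \<Rightarrow> nat \<Rightarrow> nat \<Rightarrow> nat \<Rightarrow> real" where
  "truncated_power n d s i =
     (if n - s < i then (real i - real (n - s)) ^ d / sqrt (\<Sum>u\<in>{1..s}. real u ^ (2 * d)) else 0)"

lemma truncated_power_mem_spline_vectors: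
  assumes "k \<ge> 2" "s \<ge> d + 1" "s + d + 1 \<le> n" "d0 \<le> int d - 1"
  shows "(\<lambda>i\<in>{1..n}. a * truncated_power n d s i) \<in> spline_vectors n d d0 k"
proof (rule spline_vectorsI)
  define S where "S = sqrt (\<Sum>u\<in>{1..s}. real u ^ (2 * d))"
  \<comment> \<open>The only knot that carries a nonzero polynomial is \<open>n - s\<close>. The
    factor \<open>real n ^ d\<close> below compensates for the spline being evaluated at
    \<open>i / n\<close>.\<close>
  define m where "m i = (if i = 0 then 0 else if i = 1 then n - s else n)" for i :: nat
  define q where "q i = (if i = 1 then smult (a * real n ^ d / S) ([:- (real (m i) / real n), 1:] ^ d) else 0)"
    for i :: nat
  let ?f = "\<lambda>x. \<Sum>i\<in>{1..k-1}. if real (m i) / real n < x then poly (q i) x else 0"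
  have "n > 0" using assms by simp
  show "?f \<in> spline_class n d d0 k"
  proof (rule spline_classI)
    show "mono m" by (rule incseq_SucI) (auto simp: m_def)
    fix i
    show "m (i - 1) + d + 1 \<le> m i" if "m (i - 1) < m i"
      using assms that by (auto simp: m_def split: if_splits)
    show "degree (q i) \<le> d"
      by (auto simp: q_def degree_linear_power intro: order_trans[OF degree_smult_le])
    show "[:- (real (m i) / real n), 1:] ^ nat (d0 + 1) dvd q i"
      using assms by (auto simp: q_def intro!: dvd_smult le_imp_power_dvd)
  qed (use assms in \<open>auto simp: m_def\<close>)
  fix i assume "i \<in> {1..n}"
  have "?f (real i / real n) = (\<Sum>j\<in>{1}. if real (m j) / real n < real i / real n then poly (q j) (real i / real n) else 0)"
    using assms(1) by (intro sum.mono_neutral_right) (auto simp: q_def)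
  also have "\<dots> = a * truncated_power n d s i"
    using \<open>n > 0\<close>
    by (auto simp: q_def m_def truncated_power_def S_def[symmetric] divide_less_cancel
        power_divide diff_divide_distrib[symmetric])
  finally show "?f (real i / real n) = a * truncated_power n d s i" .
qed

lemma sum_last_coordinates:
  fixes g :: "real \<Rightarrow> real"
  assumes "s \<le> n"
  shows "(\<Sum>i\<in>{1..n}. if n - s < i then g (real i - real (n - s)) else 0) = (\<Sum>u\<in>{1..s}. g (real u))"
proof -
  have "(\<Sum>i\<in>{1..n}. if n - s < i then g (real i - real (n - s)) else 0) =
      (\<Sum>i\<in>{n - s + 1..n}. g (real i - real (n - s)))"
    using assms by (intro sum.mono_neutral_cong_right) auto
  also have "\<dots> = (\<Sum>u\<in>{1..s}. g (real u))"
    using assms by (intro sum.reindex_bij_witness[where i = "\<lambda>u. u + (n - s)" and j = "\<lambda>i. i - (n - s)"])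
      (auto simp: of_nat_diff algebra_simps)
  finally show ?thesis .
qed

lemma sum_truncated_power_squared:
  assumes "1 \<le> s" "s \<le> n"
  shows "(\<Sum>i\<in>{1..n}. (truncated_power n d s i)\<^sup>2) = 1"
proof -
  define S where "S = (\<Sum>u\<in>{1..s}. real u ^ (2 * d))"
  have "S > 0" unfolding S_def using assms by (intro sum_pos) auto
  have "(\<Sum>i\<in>{1..n}. (truncated_power n d s i)\<^sup>2) =
      (\<Sum>i\<in>{1..n}. if n - s < i then (real i - real (n - s)) ^ (2 * d) / S else 0)"
    using \<open>S > 0\<close> unfolding truncated_power_def S_def[symmetric]
    by (intro sum.cong refl) (auto simp: power_divide power_even_eq)
  also have "\<dots> = (\<Sum>u\<in>{1..s}. real u ^ (2 * d) / S)"
    by (rule sum_last_coordinates[OF assms(2)])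
  also have "\<dots> = 1" using \<open>S > 0\<close> by (simp add: S_def sum_divide_distrib[symmetric])
  finally show ?thesis .
qed

text \<open>The upper half of the sum has \<open>r\<close> terms, each at least
  \<open>r ^ m\<close>. This bounds the norm of a truncated power without exact power sums.\<close>

lemma power_sum_lower_bound: "(\<Sum>u\<in>{1..2 * r}. real u ^ m) \<ge> real r ^ (m + 1)"
proof -
  have "real r ^ (m + 1) = (\<Sum>u\<in>{r + 1..2 * r}. real r ^ m)" by (simp add: One_nat_def)
  also have "\<dots> \<le> (\<Sum>u\<in>{r + 1..2 * r}. real u ^ m)"
    by (intro sum_mono power_mono) auto
  also have "\<dots> \<le> (\<Sum>u\<in>{1..2 * r}. real u ^ m)"
    by (intro sum_mono2) auto
  finally show ?thesis .
qed

text \<open>Most of the mass of the wider truncated power lies outside the support of the narrower one.\<close>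

lemma truncated_power_separated:
  assumes "1 \<le> s" "2 ^ (2 * d + 3) * s \<le> t" "even t" "t \<le> n"
  shows "(\<Sum>i\<in>{1..n}. (truncated_power n d s i - truncated_power n d t i)\<^sup>2) \<ge> 3 / 4"
proof -
  have "s * 1 \<le> s * 2 ^ (2 * d + 3)" by (intro mult_left_mono) auto
  then have "s \<le> t" using assms(2) by (simp only: mult.commute mult_1_right)
  obtain r where r: "t = 2 * r" using assms(3) by blast
  have "r > 0" using \<open>s \<le> t\<close> assms r by simp
  define S where "S = (\<Sum>u\<in>{1..t}. real u ^ (2 * d))"
  have S: "real r ^ (2 * d + 1) \<le> S" unfolding S_def r by (rule power_sum_lower_bound)
  have "S > 0" using S \<open>r > 0\<close> by (intro less_le_trans[OF _ S]) auto
  \<comment> \<open>Origin of \<open>2 ^ (2 * d + 3)\<close>: the \<open>s\<close> entries are at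
    most \<open>t ^ (2 * d) / S\<close> with \<open>S \<ge> (t / 2) ^ (2 * d + 1)\<close>, so their
    sum is at most \<open>2 ^ (2 * d + 1) * s / t\<close>, hence at most 1/4.\<close>
  have "(\<Sum>i\<in>{n - s + 1..n}. (truncated_power n d t i)\<^sup>2) \<le> (\<Sum>i\<in>{n - s + 1..n}. real t ^ (2 * d) / S)"
  proof (rule sum_mono)
    fix i assume i: "i \<in> {n - s + 1..n}"
    then have "n - t < i" using \<open>s \<le> t\<close> by auto
    then have "(truncated_power n d t i)\<^sup>2 = (real i - real (n - t)) ^ (2 * d) / S"
      using \<open>S > 0\<close> unfolding truncated_power_def S_def[symmetric]
      by (simp add: power_divide power_even_eq)
    also have "\<dots> \<le> real t ^ (2 * d) / S"
      using i \<open>n - t < i\<close> assms(4) \<open>S > 0\<close> by (intro divide_right_mono power_mono) auto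
    finally show "(truncated_power n d t i)\<^sup>2 \<le> real t ^ (2 * d) / S" .
  qed
  also have "\<dots> = real s * (real t ^ (2 * d) / S)"
    using \<open>s \<le> t\<close> assms(4) by simp
  also have "\<dots> \<le> 1 / 4"
  proof -
    have "4 * (real s * real t ^ (2 * d)) = 2 ^ (2 * d) * 4 * real s * real r ^ (2 * d)"
      by (simp add: r power_mult_distrib)
    also have "2 ^ (2 * d) * 4 * real s \<le> real r"
    proof -
      have "real (2 ^ (2 * d + 3) * s) \<le> real t" using assms(2) by (simp only: of_nat_le_iff)
      then show ?thesis by (simp add: r power_add mult_ac)
    qed
    then have "2 ^ (2 * d) * 4 * real s * real r ^ (2 * d) \<le> real r * real r ^ (2 * d)"
      by (rule mult_right_mono) simp
    also have "\<dots> \<le> S" using S by (simp add: power_add mult.commute)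
    finally show ?thesis using \<open>S > 0\<close> by (simp add: field_simps)
  qed
  finally have right: "(\<Sum>i\<in>{n - s + 1..n}. (truncated_power n d t i)\<^sup>2) \<le> 1 / 4" .
  have split: "{1..n} = {1..n - s} \<union> {n - s + 1..n}" "{1..n - s} \<inter> {n - s + 1..n} = {}"
    using \<open>s \<le> t\<close> assms(4) by auto
  have "1 = (\<Sum>i\<in>{1..n}. (truncated_power n d t i)\<^sup>2)"
    using \<open>s \<le> t\<close> assms by (intro sum_truncated_power_squared[symmetric]) auto
  also have "\<dots> = (\<Sum>i\<in>{1..n - s}. (truncated_power n d t i)\<^sup>2) + (\<Sum>i\<in>{n - s + 1..n}. (truncated_power n d t i)\<^sup>2)"
    by (subst split(1), rule sum.union_disjoint) (use split(2) in auto)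
  also have "(\<Sum>i\<in>{1..n - s}. (truncated_power n d t i)\<^sup>2) =
      (\<Sum>i\<in>{1..n - s}. (truncated_power n d s i - truncated_power n d t i)\<^sup>2)"
    by (intro sum.cong refl) (auto simp: truncated_power_def[of n d s])
  also have "\<dots> \<le> (\<Sum>i\<in>{1..n}. (truncated_power n d s i - truncated_power n d t i)\<^sup>2)"
    by (intro sum_mono2) auto
  finally show ?thesis using right by linarith
qed

lemma minimax_risk_single_knot:
  assumes "\<sigma> > 0" "k \<ge> 2" "d0 \<le> int d - 1" "M \<ge> 4" "2 ^ ((2 * d + 3) * M) + d + 1 \<le> n"
  shows "minimax_risk n \<sigma> (spline_vectors n d d0 k) \<ge> ennreal (\<sigma>\<^sup>2 * ln (real M / 4) / 16)"
proof -
  define a where "a = \<sigma> * sqrt (ln (real M / 4))"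
  have a2: "a\<^sup>2 = \<sigma>\<^sup>2 * ln (real M / 4)"
    using assms(4) by (simp add: a_def power_mult_distrib)
  define s :: "nat \<Rightarrow> nat" where "s j = 2 ^ ((2 * d + 3) * j)" for j
  have s_ge: "d + 1 \<le> s j" if "j \<ge> 1" for j
  proof -
    have "d + 1 < 2 ^ (d + 1)" by (rule less_exp)
    also have "\<dots> \<le> (2::nat) ^ ((2 * d + 3) * j)"
    proof (rule power_increasing)
      have "d + 1 \<le> (2 * d + 3) * 1" by simp
      also have "\<dots> \<le> (2 * d + 3) * j" using that by (intro mult_left_mono) auto
      finally show "d + 1 \<le> (2 * d + 3) * j" .
    qed simp
    finally show ?thesis by (simp add: s_def)
  qed
  have s_le: "s j + d + 1 \<le> n" if "j \<le> M" for j
  proof -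
    have "s j \<le> s M" unfolding s_def using that by (intro power_increasing mult_left_mono) auto
    then show ?thesis using assms(5) unfolding s_def by linarith
  qed
  have sep: "(\<Sum>i\<in>{1..n}. (truncated_power n d (s j) i - truncated_power n d (s l) i)\<^sup>2) \<ge> 3 / 4"
    if "1 \<le> j" "j < l" "l \<le> M" for j l
  proof (rule truncated_power_separated)
    have "2 ^ (2 * d + 3) * s j = 2 ^ ((2 * d + 3) * (j + 1))"
      by (simp add: s_def power_add[symmetric] algebra_simps)
    also have "\<dots> \<le> s l"
      unfolding s_def using that by (intro power_increasing mult_left_mono) auto
    finally show "2 ^ (2 * d + 3) * s j \<le> s l" .
    show "even (s l)" using that by (simp add: s_def)
  qed (use s_ge[of j] s_le[of l] that in auto)
  define v where "v b j i = (if i \<in> {1..n} then a * truncated_power n d (s j) i else 0)" for b :: unit and j i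
  \<comment> \<open>One block only. Separation \<open>3 / 4 * a\<^sup>2\<close> covers
    \<open>4 * (a\<^sup>2 / 8)\<close>; the general bound halves \<open>a\<^sup>2 / 8\<close>,
    whence the factor 1/16.\<close>
  have "ennreal (real (card {()}) * (a\<^sup>2 / 8) / 2) \<le> minimax_risk n \<sigma> (spline_vectors n d d0 k)"
  proof (rule minimax_risk_product_lower_bound[where J = "{1..M}" and I = "\<lambda>_. {1..n}" and v = v])
    fix b :: unit and j assume j: "j \<in> {1..M}"
    have "(\<Sum>i\<in>{1..n}. (v b j i)\<^sup>2) = a\<^sup>2 * (\<Sum>i\<in>{1..n}. (truncated_power n d (s j) i)\<^sup>2)"
      by (simp add: v_def sum_distrib_left power_mult_distrib)
    also have "\<dots> = a\<^sup>2"
      using j s_ge[of j] s_le[of j] by (subst sum_truncated_power_squared) auto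
    finally show "exp ((\<Sum>i\<in>{1..n}. (v b j i)\<^sup>2) / \<sigma>\<^sup>2) \<le> real (card {1..M}) / 4"
      using assms by (simp add: a2)
  next
    fix b :: unit and j l assume jl: "j \<in> {1..M}" "l \<in> {1..M}" "j \<noteq> l"
    have "(\<Sum>i\<in>{1..n}. (truncated_power n d (s j) i - truncated_power n d (s l) i)\<^sup>2) \<ge> 3 / 4"
    proof (cases "j < l")
      case False
      then show ?thesis using sep[of l j] jl by (simp add: power2_commute)
    qed (use sep[of j l] jl in auto)
    then have "a\<^sup>2 * (3 / 4) \<le> a\<^sup>2 * (\<Sum>i\<in>{1..n}. (truncated_power n d (s j) i - truncated_power n d (s l) i)\<^sup>2)"
      by (intro mult_left_mono) auto
    also have "\<dots> = (\<Sum>i\<in>{1..n}. (v b j i - v b l i)\<^sup>2)"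
      by (simp add: v_def sum_distrib_left power_mult_distrib[symmetric] right_diff_distrib)
    finally show "4 * (a\<^sup>2 / 8) \<le> (\<Sum>i\<in>{1..n}. (v b j i - v b l i)\<^sup>2)"
      using zero_le_power2[of a] by linarith
  next
    fix w assume w: "w \<in> {()} \<rightarrow>\<^sub>E {1..M}"
    have "(\<lambda>i\<in>{1..n}. \<Sum>b\<in>{()}. v b (w b) i) = (\<lambda>i\<in>{1..n}. a * truncated_power n d (s (w ())) i)"
      by (auto simp: v_def fun_eq_iff)
    also have "\<dots> \<in> spline_vectors n d d0 k"
      using w s_ge[of "w ()"] s_le[of "w ()"] assms
      by (intro truncated_power_mem_spline_vectors) (auto simp: PiE_iff)
    finally show "(\<lambda>i\<in>{1..n}. \<Sum>b\<in>{()}. v b (w b) i) \<in> spline_vectors n d d0 k" .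
  qed (use assms in \<open>auto simp: v_def disjoint_family_on_def\<close>)
  then show ?thesis by (simp add: a2)
qed

section \<open>Many bumps\<close>

text \<open>Block \<open>b\<close> has \<open>N\<close> slots of length
  \<open>(K - 1) * (d + 1)\<close>, and \<open>w b\<close> selects the slot of its bump. The extra
  \<open>d + 1\<close> in the bound on \<open>n\<close> leaves an admissible final piece.\<close>

lemma spline_vectors_bumps:
  fixes q :: "nat \<Rightarrow> real poly"
  assumes "K \<ge> 2" "m * K + 1 \<le> k" "m * N * ((K - 1) * (d + 1)) + d + 1 \<le> n"
    and deg: "\<And>r. degree (q r) \<le> d"
    and dvd: "\<And>r. [:- real (r * (d + 1)), 1:] ^ nat (d0 + 1) dvd q r"
    and w: "\<And>b. b < m \<Longrightarrow> w b < N"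
  shows "(\<lambda>i\<in>{1..n}. \<Sum>b<m. a * truncated_sum K (d + 1) q (real i - real ((b * N + w b) * ((K - 1) * (d + 1)))))
    \<in> spline_vectors n d d0 k"
proof (rule spline_vectorsI)
  define D where "D = d + 1"
  define s where "s b = (b * N + w b) * ((K - 1) * D)" for b
  \<comment> \<open>\<open>c = b * K + r\<close> numbers the \<open>r\<close>-th knot of bump
    \<open>b\<close>, and \<open>P c\<close> is its position in units of \<open>D\<close>. Knots are
    shifted by one index because \<open>knot 0\<close> is the left end.\<close>
  define P where "P c = (c div K * N + w (c div K)) * (K - 1) + c mod K" for c
  define knot where "knot i = (if i = 0 then 0 else if i \<le> m * K then D * P (i - 1) else n)" for i
  define lin where "lin b = [:- real (s b), real n:]" for b
  define Q where "Q i = (if i \<le> m * K then smult a (pcompose (q ((i - 1) mod K)) (lin ((i - 1) div K))) else 0)" for i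
  let ?f = "\<lambda>x. \<Sum>i\<in>{1..k-1}. if real (knot i) / real n < x then poly (Q i) x else 0"
  have "n > 0" using assms(3) by simp
  have div: "c div K < m" if "c < m * K" for c
    using that by (simp add: less_mult_imp_div_less)
  have P_Suc: "P c \<le> P (c + 1)" if c: "c + 1 < m * K" for c
  proof (cases "(c + 1) mod K = 0")
    \<comment> \<open>Passing to the next bump. The two knots coincide when the first bump fills the
      last slot of its block and the second the first slot of its own.\<close>
    case True
    then have md: "c mod K = K - 1" and dv: "(c + 1) div K = c div K + 1"
      using assms(1) by (auto simp: One_nat_def mod_Suc div_Suc split: if_splits)
    have "w (c div K) + 1 \<le> N" using w[OF div[of c]] c by linarith
    then have "(c div K * N + w (c div K) + 1) * (K - 1) \<le> ((c div K + 1) * N + w (c div K + 1)) * (K - 1)"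
      by (intro mult_right_mono) (simp_all add: distrib_right)
    then show ?thesis unfolding P_def True dv md by (simp add: distrib_right)
  next
    case False
    then have "(c + 1) mod K = c mod K + 1" "(c + 1) div K = c div K"
      using assms(1) by (auto simp: One_nat_def mod_Suc div_Suc split: if_splits)
    then show ?thesis unfolding P_def by simp
  qed
  have P_le: "D * P c \<le> n - D" if c: "c < m * K" for c
  proof -
    have "c div K * N + w (c div K) + 1 \<le> (c div K + 1) * N"
      using w[OF div[OF c]] by (simp add: distrib_right)
    also have "\<dots> \<le> m * N" using div[OF c] by (intro mult_right_mono) auto
    finally have "(c div K * N + w (c div K) + 1) * (K - 1) \<le> m * N * (K - 1)"
      by (rule mult_right_mono) simp
    moreover have "c mod K < K" using assms(1) by simp
    then have "c mod K \<le> K - 1" by linarith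
    ultimately have "P c \<le> m * N * (K - 1)" unfolding P_def by (simp add: distrib_right)
    then have "D * P c \<le> D * (m * N * (K - 1))" by (rule mult_left_mono) simp
    also have "\<dots> = m * N * ((K - 1) * (d + 1))" by (simp add: D_def)
    finally show ?thesis using assms(3) unfolding D_def by linarith
  qed
  have knot_step: "knot i = knot (i + 1) \<or> knot i + D \<le> knot (i + 1)" for i
  proof -
    consider "i = 0" "1 \<le> m * K" | "i \<ge> 1" "i + 1 \<le> m * K" | "i \<ge> 1" "i = m * K" | "i = 0" "m * K = 0" | "i > m * K"
      by linarith
    then show ?thesis
    proof cases
      case 1
      \<comment> \<open>The first bump may start at 0, and then \<open>knot 1\<close> coincides with
        \<open>knot 0\<close>.\<close>
      then show ?thesis by (cases "P 0") (auto simp: knot_def)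
    next
      case 2
      then have "P (i - 1) = P i \<or> P (i - 1) + 1 \<le> P i" using P_Suc[of "i - 1"] by auto
      then show ?thesis
      proof
        assume "P (i - 1) + 1 \<le> P i"
        then have "D * (P (i - 1) + 1) \<le> D * P i" by (rule mult_left_mono) simp
        moreover have "knot i = D * P (i - 1)" "knot (i + 1) = D * P i"
          using 2 by (simp_all add: knot_def)
        ultimately show ?thesis by (simp only: distrib_left mult_1_right simp_thms)
      qed (use 2 in \<open>simp add: knot_def\<close>)
    next
      case 3
      then show ?thesis using P_le[of "i - 1"] assms(3) by (auto simp: knot_def D_def)
    next
      case 4
      then show ?thesis using assms(3) by (auto simp: knot_def D_def)
    qed (auto simp: knot_def)
  qed
  have s_knot: "real (knot (b * K + r + 1)) = real (s b) + real (r * D)"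
      and sum_Q: "Q (b * K + r + 1) = smult a (pcompose (q r) (lin b))" if "b < m" "r < K" for b r
  proof -
    have "b * K + r + 1 \<le> b * K + K" using that by simp
    also have "\<dots> = (b + 1) * K" by (simp add: distrib_right)
    also have "\<dots> \<le> m * K" using that by (intro mult_right_mono) auto
    finally have "b * K + r + 1 \<le> m * K" .
    then show "real (knot (b * K + r + 1)) = real (s b) + real (r * D)"
      and "Q (b * K + r + 1) = smult a (pcompose (q r) (lin b))"
      using that by (simp_all add: knot_def Q_def P_def s_def algebra_simps)
  qed
  show "?f \<in> spline_class n d d0 k"
  proof (rule spline_classI)
    show "mono knot"
    proof (rule incseq_SucI)
      show "knot i \<le> knot (Suc i)" for i using knot_step[of i] by (auto simp: One_nat_def)
    qed
    show "knot k = n" "knot 0 = 0" using assms(2) by (auto simp: knot_def)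
    fix i assume i: "i \<in> {1..k}"
    show "knot (i - 1) + d + 1 \<le> knot i" if "knot (i - 1) < knot i"
      using knot_step[of "i - 1"] i that by (auto simp: D_def)
  next
    fix i assume i: "i \<in> {1..k-1}"
    have "degree (pcompose (q ((i - 1) mod K)) (lin ((i - 1) div K))) \<le> d"
      using deg[of "(i - 1) mod K"] \<open>n > 0\<close> by (simp add: lin_def degree_pcompose)
    then show "degree (Q i) \<le> d"
      by (auto simp: Q_def intro: order_trans[OF degree_smult_le])
    show "[:- (real (knot i) / real n), 1:] ^ nat (d0 + 1) dvd Q i"
    proof (cases "i \<le> m * K")
      case True
      define b r where "b = (i - 1) div K" and "r = (i - 1) mod K"
      have br: "b < m" "r < K" "i = b * K + r + 1"
        using True i div[of "i - 1"] assms(1) by (auto simp: b_def r_def)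
      \<comment> \<open>The affine change of variable carries the root at \<open>r * D\<close>, with
        its multiplicity, to the rescaled knot.\<close>
      have "pcompose [:- real (r * D), 1:] (lin b) = smult (real n) [:- (real (knot i) / real n), 1:]"
        using \<open>n > 0\<close> s_knot[OF br(1,2)] by (simp add: br(3) lin_def pcompose_pCons)
      moreover obtain t where "q r = [:- real (r * D), 1:] ^ nat (d0 + 1) * t"
        using dvd[of r] by (auto simp: D_def elim: dvdE)
      ultimately have "pcompose (q r) (lin b) =
          smult (real n) [:- (real (knot i) / real n), 1:] ^ nat (d0 + 1) * pcompose t (lin b)"
        by (simp only: pcompose_mult pcompose_power)
      then have "[:- (real (knot i) / real n), 1:] ^ nat (d0 + 1) dvd pcompose (q r) (lin b)"
        by (simp only: smult_power mult_smult_left) (intro dvd_smult dvd_triv_left)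
      then show ?thesis using sum_Q[OF br(1,2)] by (simp add: br(3) dvd_smult)
    qed (simp add: Q_def)
  qed (rule \<open>n > 0\<close>)
  fix i assume "i \<in> {1..n}"
  define F where "F j = (if real (knot j) / real n < real i / real n then poly (Q j) (real i / real n) else 0)" for j
  have "?f (real i / real n) = (\<Sum>j\<in>{1..m * K}. F j)"
    unfolding F_def using assms(2) by (intro sum.mono_neutral_right) (auto simp: Q_def)
  also have "\<dots> = (\<Sum>j<m * K. F (j + 1))"
    by (intro sum.reindex_bij_witness[where i = "\<lambda>j. j + 1" and j = "\<lambda>j. j - 1"]) auto
  also have "\<dots> = (\<Sum>b<m. \<Sum>j\<in>{b * K..<b * K + K}. F (j + 1))"
    by (rule sum.nat_group[symmetric])
  also have "\<dots> = (\<Sum>b<m. \<Sum>r<K. F (b * K + r + 1))"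
  proof (rule sum.cong[OF refl])
    show "(\<Sum>j\<in>{b * K..<b * K + K}. F (j + 1)) = (\<Sum>r<K. F (b * K + r + 1))" for b
      by (intro sum.reindex_bij_witness[where i = "\<lambda>r. b * K + r" and j = "\<lambda>j. j - b * K"]) auto
  qed
  also have "\<dots> = (\<Sum>b<m. a * truncated_sum K D q (real i - real (s b)))"
    unfolding truncated_sum_def sum_distrib_left
  proof (intro sum.cong refl)
    fix b r assume br: "b \<in> {..<m}" "r \<in> {..<K}"
    have "real (knot (b * K + r + 1)) / real n < real i / real n \<longleftrightarrow> real (r * D) < real i - real (s b)"
      using br \<open>n > 0\<close> by (subst s_knot) (auto simp: divide_less_cancel)
    moreover have "poly (lin b) (real i / real n) = real i - real (s b)"
      using \<open>n > 0\<close> by (simp add: lin_def)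
    ultimately show "F (b * K + r + 1) = a * (if real (r * D) < real i - real (s b) then poly (q r) (real i - real (s b)) else 0)"
      using br by (simp add: F_def sum_Q poly_pcompose)
  qed
  finally show "?f (real i / real n) =
      (\<Sum>b<m. a * truncated_sum K (d + 1) q (real i - real ((b * N + w b) * ((K - 1) * (d + 1)))))"
    by (simp add: s_def D_def)
qed

text \<open>Bumps in different slots have disjoint supports, so two shifts in a block are
  orthogonal, at squared distance twice their squared norm.\<close>

lemma minimax_risk_bumps:
  assumes "\<sigma> > 0" "-1 \<le> d0" "d0 \<le> int d - 1" "K \<ge> 2" "d + 1 < K * nat (int d - d0)" "N \<ge> 4"
    and "m * K + 1 \<le> k" "m * N * ((K - 1) * (d + 1)) + d + 1 \<le> n"
  shows "minimax_risk n \<sigma> (spline_vectors n d d0 k) \<ge> ennreal (real m * (\<sigma>\<^sup>2 * ln (real N / 4)) / 4)"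
proof -
  define D where "D = d + 1"
  define L where "L = (K - 1) * D"
  \<comment> \<open>The exponents from \<open>nat (d0 + 1)\<close> to \<open>d\<close> number
    \<open>d - d0\<close>, which is the contribution of one knot to the dimension count.\<close>
  have "nat (d0 + 1) \<le> d" "d + 1 - nat (d0 + 1) = nat (int d - d0)" using assms by linarith+
  then obtain q :: "nat \<Rightarrow> real poly" where q: "\<And>r. degree (q r) \<le> d"
      "\<And>r. [:- real (r * D), 1:] ^ nat (d0 + 1) dvd q r" "(\<Sum>r<K. q r) = 0"
      "(\<Sum>u\<in>{1..L}. (truncated_sum K D q (real u))\<^sup>2) = 1"
    using exists_compactly_supported_spline[of "nat (d0 + 1)" d K D] assms(5)
    unfolding L_def D_def by auto
  define a where "a = \<sigma> * sqrt (ln (real N / 4))"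
  have a2: "a\<^sup>2 = \<sigma>\<^sup>2 * ln (real N / 4)"
    using assms by (simp add: a_def power_mult_distrib)
  define g where "g p i = a * truncated_sum K D q (real i - real (p * L))" for p i
  have g_zero: "g p i = 0" if "i \<notin> {p * L + 1..p * L + L}" for p i
  proof (cases "i \<le> p * L")
    case True
    then show ?thesis by (simp add: g_def truncated_sum_left del: of_nat_mult)
  next
    case False
    then have "p * L + L < i" using that by auto
    then have "real L < real i - real (p * L)" by linarith
    then show ?thesis using truncated_sum_right[OF q(3)] by (simp add: g_def L_def)
  qed
  have g_norm: "(\<Sum>i\<in>S. (g p i)\<^sup>2) = a\<^sup>2" if "{p * L + 1..p * L + L} \<subseteq> S" "finite S" for p S
  proof -
    have "(\<Sum>i\<in>S. (g p i)\<^sup>2) = (\<Sum>i\<in>{p * L + 1..p * L + L}. (g p i)\<^sup>2)"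
      using that g_zero by (intro sum.mono_neutral_right) auto
    also have "\<dots> = (\<Sum>u\<in>{1..L}. a\<^sup>2 * (truncated_sum K D q (real u))\<^sup>2)"
      by (intro sum.reindex_bij_witness[where i = "\<lambda>u. u + p * L" and j = "\<lambda>i. i - p * L"])
        (auto simp: g_def power_mult_distrib of_nat_diff)
    also have "\<dots> = a\<^sup>2" using q(4) by (simp add: sum_distrib_left[symmetric])
    finally show ?thesis .
  qed
  define I where "I b = {b * N * L + 1..(b + 1) * N * L}" for b
  define v where "v b j = g (b * N + j)" for b j
  have supp: "{(b * N + j) * L + 1..(b * N + j) * L + L} \<subseteq> I b" if "j < N" for b j
  proof -
    have "(b * N + j + 1) * L \<le> ((b + 1) * N) * L"
      using that by (intro mult_right_mono) (auto simp: distrib_right)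
    moreover have "b * N * L \<le> (b * N + j) * L" by (intro mult_right_mono) auto
    ultimately show ?thesis by (auto simp: I_def distrib_right)
  qed
  have norm: "(\<Sum>i\<in>I b. (v b j i)\<^sup>2) = a\<^sup>2" if "j < N" for b j
    unfolding v_def using supp[OF that] by (intro g_norm) (auto simp: I_def)
  have "ennreal (real (card {..<m}) * (a\<^sup>2 / 2) / 2) \<le> minimax_risk n \<sigma> (spline_vectors n d d0 k)"
  proof (rule minimax_risk_product_lower_bound[where J = "{..<N}" and I = I and v = v])
    fix b assume "b \<in> {..<m}"
    then have "(b + 1) * N * L \<le> m * N * L" by (intro mult_right_mono) auto
    also have "\<dots> \<le> n" using assms(8) by (simp add: L_def D_def)
    finally show "I b \<subseteq> {1..n}" by (auto simp: I_def)
  next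
    have "I b \<inter> I c = {}" if "b < c" for b c
    proof -
      have "(b + 1) * N * L \<le> c * N * L" using that by (intro mult_right_mono) auto
      then show ?thesis
        unfolding I_def by (intro equals0I, unfold Int_iff atLeastAtMost_iff) linarith
    qed
    then show "disjoint_family_on I {..<m}"
      unfolding disjoint_family_on_def by (metis Int_commute linorder_neqE_nat)
  next
    fix b j i assume "j \<in> {..<N}" "i \<notin> I b"
    then show "v b j i = 0" unfolding v_def using supp[of j b] by (intro g_zero) auto
  next
    fix b j assume "j \<in> {..<N}"
    then show "exp ((\<Sum>i\<in>I b. (v b j i)\<^sup>2) / \<sigma>\<^sup>2) \<le> real (card {..<N}) / 4"
      using assms by (simp add: norm a2)
  next
    fix b j l assume jl: "j \<in> {..<N}" "l \<in> {..<N}" "j \<noteq> l"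
    have disj: "v b j i * v b l i = 0" for i
    proof (rule ccontr)
      assume "v b j i * v b l i \<noteq> 0"
      then have i: "i \<in> {(b * N + j) * L + 1..(b * N + j) * L + L}" "i \<in> {(b * N + l) * L + 1..(b * N + l) * L + L}"
        using g_zero unfolding v_def by auto
      have "(b * N + j + 1) * L \<le> (b * N + l) * L \<or> (b * N + l + 1) * L \<le> (b * N + j) * L"
      proof (cases "j < l")
        case True
        then show ?thesis by (intro disjI1 mult_right_mono) auto
      next
        case False
        then show ?thesis using jl(3) by (intro disjI2 mult_right_mono) auto
      qed
      then show False using i unfolding atLeastAtMost_iff distrib_right mult_1 by linarith
    qed
    have "(\<Sum>i\<in>I b. (v b j i - v b l i)\<^sup>2) = (\<Sum>i\<in>I b. (v b j i)\<^sup>2 + (v b l i)\<^sup>2)"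
      using disj by (intro sum.cong refl) (auto simp: power2_diff)
    also have "\<dots> = 2 * a\<^sup>2" using jl by (simp add: sum.distrib norm)
    finally show "4 * (a\<^sup>2 / 2) \<le> (\<Sum>i\<in>I b. (v b j i - v b l i)\<^sup>2)" by simp
  next
    fix w assume "w \<in> {..<m} \<rightarrow>\<^sub>E {..<N}"
    then show "(\<lambda>i\<in>{1..n}. \<Sum>b\<in>{..<m}. v b (w b) i) \<in> spline_vectors n d d0 k"
      unfolding v_def g_def L_def D_def using assms q
      by (intro spline_vectors_bumps) (auto simp: D_def)
  qed (use assms in \<open>auto simp: lessThan_empty_iff\<close>)
  then show ?thesis by (simp add: a2)
qed

section \<open>Choice of the constants\<close>

lemma minimax_risk_few_pieces:
  fixes d n k :: nat
  defines "E \<equiv> 2 * d + 3"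
  assumes "\<sigma> > 0" "d0 \<le> int d - 1" "2 \<le> k" "k \<le> d + 2"
    and "n \<ge> 2 * d + 2" "n \<ge> 2 * 2 ^ (E * (16 * E + 66))"
  shows "minimax_risk n \<sigma> (spline_vectors n d d0 k) \<ge>
    ennreal (1 / (32 * (real d + 2)) * \<sigma>\<^sup>2 * real k * ln (ln (16 * real n / real k)))"
proof -
  define e where "e = real E"
  \<comment> \<open>The number of scales that fit below \<open>n / 2\<close>; the other half of
    \<open>n\<close> leaves \<open>d + 1\<close> points before the knot.\<close>
  define x where "x = log 2 (real n / 2) / e"
  define M where "M = nat \<lfloor>x\<rfloor>"
  have "e \<ge> 3" by (simp add: e_def E_def)
  have "n > 0" using assms(6) by simp
  have "e * (16 * e + 66) \<le> log 2 (real n / 2)"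
  proof -
    have "real (2 * 2 ^ (E * (16 * E + 66))) \<le> real n" using assms(7) by (simp only: of_nat_le_iff)
    then have "2 powr real (E * (16 * E + 66)) \<le> real n / 2" by (subst powr_realpow) simp_all
    then have "real (E * (16 * E + 66)) \<le> log 2 (real n / 2)"
      using \<open>n > 0\<close> by (subst le_log_iff) auto
    then show ?thesis by (simp add: e_def)
  qed
  then have x: "16 * e + 66 \<le> x" using \<open>e \<ge> 3\<close> by (simp add: x_def field_simps)
  have Mx: "real M \<le> x" "x - 1 < real M"
    using x \<open>e \<ge> 3\<close> unfolding M_def by linarith+
  then have "M \<ge> 4" using x \<open>e \<ge> 3\<close> by linarith
  have "2 ^ (E * M) + d + 1 \<le> n"
  proof -
    have "e * real M \<le> log 2 (real n / 2)" using Mx \<open>e \<ge> 3\<close> by (simp add: x_def field_simps)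
    then have "2 powr (e * real M) \<le> real n / 2"
      using \<open>n > 0\<close> by (subst (asm) le_log_iff) auto
    then have "2 powr real (E * M) \<le> real n / 2" by (simp add: e_def)
    then have "real (2 ^ (E * M)) \<le> real n / 2" by (subst (asm) powr_realpow) auto
    then have "real (2 * 2 ^ (E * M)) \<le> real n" by simp
    then have "2 * 2 ^ (E * M) \<le> n" by (simp only: of_nat_le_iff)
    then show ?thesis using assms(6) by linarith
  qed
  then have "ennreal (\<sigma>\<^sup>2 * ln (real M / 4) / 16) \<le> minimax_risk n \<sigma> (spline_vectors n d d0 k)"
    using assms \<open>M \<ge> 4\<close> unfolding E_def by (intro minimax_risk_single_knot) auto
  \<comment> \<open>It suffices to bound the inner logarithm by a square, which the outer one turns
    into a factor 2.\<close>
  moreover have "ln (ln (16 * real n / real k)) \<le> 2 * ln (real M / 4)"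
  proof -
    have "ln (16 * real n / real k) \<le> ln (8 * real n)"
      using assms(4) \<open>n > 0\<close> by (intro ln_mono) (auto simp: field_simps)
    also have "8 * real n = 2 ^ 4 * (real n / 2)" by simp
    also have "ln (2 ^ 4 * (real n / 2)) = ln (2 ^ 4) + ln (real n / 2)"
      using \<open>n > 0\<close> by (intro ln_mult_pos) auto
    also have "ln (2 ^ 4) = 4 * ln (2 :: real)" by (subst ln_realpow) auto
    also have "ln (real n / 2) = e * x * ln 2"
      using \<open>e \<ge> 3\<close> by (simp add: x_def log_def)
    also have "4 * ln 2 + e * x * ln 2 = (4 + e * x) * ln 2" by (simp add: distrib_right)
    also have "\<dots> \<le> (4 + e * x) * 1"
      using ln_2_less_1 \<open>e \<ge> 3\<close> x by (intro mult_left_mono) auto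
    \<comment> \<open>The threshold \<open>16 * e + 66\<close> is made for this:
      \<open>x\<^sup>2\<close> absorbs \<open>16 * e * x\<close>, and \<open>66 * x\<close> remains
      for the lower-order terms.\<close>
    also have "\<dots> \<le> (x - 1)\<^sup>2 / 16"
    proof -
      have "(16 * e + 66) * x \<le> x * x" using x \<open>e \<ge> 3\<close> by (intro mult_right_mono) auto
      then show ?thesis using x \<open>e \<ge> 3\<close> by (simp add: power2_eq_square algebra_simps)
    qed
    also have "\<dots> \<le> (real M / 4)\<^sup>2"
    proof -
      have "(x - 1)\<^sup>2 \<le> (real M)\<^sup>2" using Mx x \<open>e \<ge> 3\<close> by (intro power_mono) auto
      then show ?thesis by (simp add: power_divide)
    qed
    finally have *: "ln (16 * real n / real k) \<le> (real M / 4)\<^sup>2" .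
    have "real k < 16 * real n" using assms(5,6) by linarith
    then have "0 < ln (16 * real n / real k)" using assms(4) by simp
    then have "ln (ln (16 * real n / real k)) \<le> ln ((real M / 4)\<^sup>2)" using * by (intro ln_mono) auto
    also have "\<dots> = 2 * ln (real M / 4)" using \<open>M \<ge> 4\<close> by (simp add: ln_realpow)
    finally show ?thesis .
  qed
  moreover have "0 \<le> ln (real M / 4)" using \<open>M \<ge> 4\<close> by simp
  ultimately have "1 / (32 * (real d + 2)) * \<sigma>\<^sup>2 * real k * ln (ln (16 * real n / real k)) \<le>
      1 / (32 * (real d + 2)) * \<sigma>\<^sup>2 * (real d + 2) * (2 * ln (real M / 4))"
  proof -
    have "real k * ln (ln (16 * real n / real k)) \<le> real k * (2 * ln (real M / 4))"
      using \<open>ln (ln _) \<le> _\<close> by (intro mult_left_mono) auto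
    also have "\<dots> \<le> (real d + 2) * (2 * ln (real M / 4))"
      using assms(5) \<open>0 \<le> ln (real M / 4)\<close> by (intro mult_right_mono) auto
    finally have "1 / (32 * (real d + 2)) * \<sigma>\<^sup>2 * (real k * ln (ln (16 * real n / real k))) \<le>
        1 / (32 * (real d + 2)) * \<sigma>\<^sup>2 * ((real d + 2) * (2 * ln (real M / 4)))"
      by (rule mult_left_mono) simp
    then show ?thesis by (simp only: mult.assoc)
  qed
  also have "\<dots> = \<sigma>\<^sup>2 * ln (real M / 4) / 16" by (simp add: field_simps)
  finally show ?thesis
    using \<open>ennreal (\<sigma>\<^sup>2 * ln (real M / 4) / 16) \<le> _\<close> by (meson ennreal_leI order_trans)
qed

lemma minimax_risk_many_pieces:
  fixes d n k :: nat
  defines "A \<equiv> 64 * (d + 1)\<^sup>2"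
  defines "C \<equiv> 1 + (1 + ln (16 * (real d + 1)\<^sup>2)) / ln 2"
  assumes "\<sigma> > 0" "-1 \<le> d0" "d0 \<le> int d - 1" "2 \<le> K" "K \<le> d + 2" "d + 1 < K * nat (int d - d0)"
    and "K + 1 \<le> k" "k \<le> n" "n \<ge> 2 * d + 2" "n \<ge> A"
  shows "minimax_risk n \<sigma> (spline_vectors n d d0 k) \<ge>
    ennreal (1 / (4 * C * (real A + real d + 2)) * \<sigma>\<^sup>2 * real k * ln (exp 1 * real n / real k))"
proof -
  \<comment> \<open>As \<open>K \<le> A\<close>, these blocks use at most \<open>k - 1\<close>
    knots; the size of \<open>A\<close> leaves at least 8 slots in each, even for
    \<open>k = n\<close>.\<close>
  define m where "m = 1 + (k - K - 1) div A"
  define L where "L = (K - 1) * (d + 1)"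
  define N where "N = (n - (d + 1)) div (m * L)"
  have "A > 0" by (simp add: A_def)
  have "m \<ge> 1" by (simp add: m_def)
  have "L \<ge> 1" using mult_le_mono[of 1 "K - 1" 1 "d + 1"] assms(6) unfolding L_def by linarith
  have "L \<le> (d + 1)\<^sup>2" using assms(7) unfolding L_def power2_eq_square by (intro mult_right_mono) auto
  then have L_le: "real L \<le> (real d + 1)\<^sup>2"
    by (metis of_nat_1 of_nat_add of_nat_le_iff of_nat_power)
  have mA: "(m - 1) * A \<le> k - K - 1" by (simp add: m_def)
  have "m - 1 \<le> (m - 1) * A" using \<open>A > 0\<close> by simp
  then have mk: "m \<le> k" using mA assms(6,9) \<open>m \<ge> 1\<close> by linarith
  have "d + 1 \<le> (d + 1) * (d + 1)" by simp
  then have "K \<le> A" using assms(7) unfolding A_def power2_eq_square by linarith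
  then have "(m - 1) * K \<le> (m - 1) * A" by (rule mult_left_mono) simp
  then have "(m - 1) * K + K + 1 \<le> k" using mA assms(9) by linarith
  then have mK: "m * K + 1 \<le> k" by (simp add: m_def distrib_right)
  have mN: "m * N * ((K - 1) * (d + 1)) + d + 1 \<le> n"
  proof -
    have "m * L * N \<le> n - (d + 1)" by (simp add: N_def)
    then show ?thesis using assms(11) unfolding L_def by (simp add: mult_ac)
  qed
  define x where "x = (real n - real d - 1) / (real m * real L)"
  have half: "real n / 2 \<le> real n - real d - 1" using assms(11) by linarith
  have mL: "real m * real L > 0" using \<open>m \<ge> 1\<close> \<open>L \<ge> 1\<close> by simp
  \<comment> \<open>From \<open>m * A \<le> 2 * n\<close> and \<open>64 * L \<le> A\<close> follows
    \<open>m * L \<le> n / 32\<close>, while at least \<open>n / 2\<close> points are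
    available.\<close>
  have "16 \<le> x"
  proof -
    have "real ((m - 1) * A) \<le> real n" using mA assms(10) by linarith
    then have "real m * real A \<le> 2 * real n"
      using \<open>m \<ge> 1\<close> assms(12) by (simp add: of_nat_diff algebra_simps)
    moreover have "64 * real L \<le> real A" using L_le unfolding A_def by (simp add: add.commute)
    then have "real m * (64 * real L) \<le> real m * real A" by (rule mult_left_mono) simp
    ultimately have "16 * (real m * real L) \<le> real n / 2" by simp
    then show ?thesis using half mL by (simp add: x_def field_simps)
  qed
  have "x < real N + 1"
  proof -
    have "n - (d + 1) < m * L * (N + 1)"
      using mL unfolding N_def by (metis One_nat_def Suc_eq_plus1 dividend_less_times_div mult.commute of_nat_0_less_iff of_nat_mult add.commute mult_Suc_right)
    then have "real (n - (d + 1)) < real (m * L * (N + 1))" by (simp only: of_nat_less_iff)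
    then have "real n - real d - 1 < real m * real L * (real N + 1)"
      using assms(11) by (simp add: of_nat_diff)
    then show ?thesis using mL by (simp add: x_def divide_less_eq mult_ac)
  qed
  then have Nx: "x / 2 \<le> real N" "8 \<le> real N" using \<open>16 \<le> x\<close> by linarith+
  have nk: "real n / real k / (16 * (real d + 1)\<^sup>2) \<le> real N / 4"
  proof -
    have "real m * real L \<le> real k * (real d + 1)\<^sup>2"
      using mk L_le by (intro mult_mono) auto
    then have "real n / (real k * (real d + 1)\<^sup>2) \<le> real n / (real m * real L)"
      using mL by (intro divide_left_mono) (auto simp: mult_pos_pos)
    also have "\<dots> \<le> 2 * x" using half mL by (simp add: x_def field_simps)
    finally have "real n / (real k * (real d + 1)\<^sup>2) / 16 \<le> 2 * x / 16"
      by (rule divide_right_mono) simp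
    also have "\<dots> \<le> real N / 4" using Nx by linarith
    finally show ?thesis by (simp add: mult_ac)
  qed
  have "ln 2 \<le> ln (real N / 4)" using Nx by simp
  have "k > 0" "n > 0" using assms by linarith+
  have "ln (real n / real k) - ln (16 * (real d + 1)\<^sup>2) \<le> ln (real N / 4)"
  proof -
    have "ln (real n / real k) - ln (16 * (real d + 1)\<^sup>2) = ln (real n / real k / (16 * (real d + 1)\<^sup>2))"
      using \<open>k > 0\<close> \<open>n > 0\<close> by (intro ln_divide_pos[symmetric]) auto
    also have "\<dots> \<le> ln (real N / 4)" using nk \<open>k > 0\<close> \<open>n > 0\<close> by (intro ln_mono) auto
    finally show ?thesis .
  qed
  \<comment> \<open>\<open>N \<ge> 8\<close> keeps \<open>ln (N / 4)\<close> at least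
    \<open>ln 2\<close>, so additive constants are absorbed into the factor
    \<open>C\<close>.\<close>
  moreover have "1 + ln (16 * (real d + 1)\<^sup>2) \<le> (1 + ln (16 * (real d + 1)\<^sup>2)) / ln 2 * ln (real N / 4)"
  proof -
    have "1 \<le> (real d + 1)\<^sup>2" by simp
    then have "0 \<le> ln (16 * (real d + 1)\<^sup>2)" by (intro ln_ge_zero) linarith
    then have "(1 + ln (16 * (real d + 1)\<^sup>2)) * ln 2 \<le> (1 + ln (16 * (real d + 1)\<^sup>2)) * ln (real N / 4)"
      using \<open>ln 2 \<le> ln (real N / 4)\<close> by (intro mult_left_mono) auto
    then show ?thesis by (simp add: field_simps)
  qed
  moreover have "ln (exp 1 * real n / real k) = 1 + ln (real n / real k)"
    using \<open>k > 0\<close> \<open>n > 0\<close> by (simp add: ln_mult ln_div)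
  ultimately have log_le: "ln (exp 1 * real n / real k) \<le> C * ln (real N / 4)"
    by (simp add: C_def distrib_right)
  have "C > 0"
  proof -
    have "1 \<le> (real d + 1)\<^sup>2" by simp
    then have "0 \<le> ln (16 * (real d + 1)\<^sup>2)" by (intro ln_ge_zero) linarith
    then show ?thesis unfolding C_def by (intro add_pos_nonneg divide_nonneg_nonneg) auto
  qed
  have k_le: "real k \<le> (real A + real d + 2) * real m"
  proof -
    have "k - K - 1 < (m - 1) * A + A"
      using \<open>A > 0\<close> unfolding m_def by (simp add: dividend_less_div_times add.commute)
    then have "k \<le> m * A + K" using \<open>m \<ge> 1\<close> by (cases m) auto
    also have "\<dots> \<le> m * A + (d + 2) * m"
      using assms(7) \<open>m \<ge> 1\<close> by (intro add_left_mono) (metis mult.right_neutral mult_le_mono)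
    finally have "real k \<le> real (m * A + (d + 2) * m)" by (simp only: of_nat_le_iff)
    then show ?thesis by (simp add: algebra_simps)
  qed
  have "ennreal (real m * (\<sigma>\<^sup>2 * ln (real N / 4)) / 4) \<le> minimax_risk n \<sigma> (spline_vectors n d d0 k)"
    using assms Nx mK mN by (intro minimax_risk_bumps) auto
  moreover have "1 / (4 * C * (real A + real d + 2)) * \<sigma>\<^sup>2 * real k * ln (exp 1 * real n / real k) \<le>
      real m * (\<sigma>\<^sup>2 * ln (real N / 4)) / 4"
  proof -
    have "real k * ln (exp 1 * real n / real k) \<le> ((real A + real d + 2) * real m) * (C * ln (real N / 4))"
      using k_le log_le \<open>k \<le> n\<close> \<open>k > 0\<close>
      by (intro mult_mono) (auto intro!: ln_ge_zero mult_nonneg_nonneg simp: \<open>ln (exp 1 * _ / _) = _\<close>)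
    then have "1 / (4 * C * (real A + real d + 2)) * \<sigma>\<^sup>2 * (real k * ln (exp 1 * real n / real k)) \<le>
        1 / (4 * C * (real A + real d + 2)) * \<sigma>\<^sup>2 * (((real A + real d + 2) * real m) * (C * ln (real N / 4)))"
      using \<open>C > 0\<close> by (intro mult_left_mono) auto
    also have "\<dots> = real m * (\<sigma>\<^sup>2 * ln (real N / 4)) / 4"
    proof -
      have "1 / (4 * C * B) * s * ((B * t) * (C * l)) = t * (s * l) / 4" if "B > 0" for B s t l
        using that \<open>C > 0\<close> by (simp add: field_simps)
      moreover have "real A + real d + 2 > 0" by simp
      ultimately show ?thesis by blast
    qed
    finally show ?thesis by (simp only: mult.assoc)
  qed
  ultimately show ?thesis by (meson ennreal_leI order_trans)
qed

theorem proposition2p2: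
  fixes d :: nat
  shows "\<exists>c::real. c > 0 \<and> (\<exists>n0::nat. \<forall>d0::int. -1 \<le> d0 \<and> d0 \<le> int d - 1 \<longrightarrow>
    (let k0 = \<lfloor>real (d + 1) / real_of_int (int d - d0)\<rfloor> + 1 in
      \<forall>(n::nat) (k::nat) (\<sigma>::real). n \<ge> n0 \<and> 2 \<le> k \<and> k \<le> n \<and> \<sigma> > 0 \<longrightarrow>
        (int k \<le> k0 \<longrightarrow>
           minimax_risk n \<sigma> (spline_vectors n d d0 k)
             \<ge> ennreal (c * \<sigma>\<^sup>2 * real k * ln (ln (16 * real n / real k)))) \<and>
        (int k \<ge> k0 + 1 \<longrightarrow>
           minimax_risk n \<sigma> (spline_vectors n d d0 k)
             \<ge> ennreal (c * \<sigma>\<^sup>2 * real k * ln (exp 1 * real n / real k)))))"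
proof -
  define E where "E = 2 * d + 3"
  define A where "A = 64 * (d + 1)\<^sup>2"
  define C where "C = 1 + (1 + ln (16 * (real d + 1)\<^sup>2)) / ln 2"
  define c1 where "c1 = 1 / (32 * (real d + 2))"
  define c2 where "c2 = 1 / (4 * C * (real A + real d + 2))"
  define n0 where "n0 = 2 * d + 2 + 2 * 2 ^ (E * (16 * E + 66)) + A"
  have "C > 0"
  proof -
    have "1 \<le> (real d + 1)\<^sup>2" by simp
    then have "0 \<le> ln (16 * (real d + 1)\<^sup>2)" by (intro ln_ge_zero) linarith
    then show ?thesis unfolding C_def by (intro add_pos_nonneg divide_nonneg_nonneg) auto
  qed
  then have "c1 > 0" "c2 > 0" by (auto simp: c1_def c2_def intro!: divide_pos_pos mult_pos_pos add_nonneg_pos)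
  \<comment> \<open>Shrinking the constant weakens a bound only if the logarithmic factor is
    nonnegative, so this is checked for both factors.\<close>
  have scale: "ennreal (min c1 c2 * \<sigma>\<^sup>2 * real k * t) \<le> R"
    if "ennreal (c * \<sigma>\<^sup>2 * real k * t) \<le> R" "min c1 c2 \<le> c" "t \<ge> 0" for c \<sigma> t R and k :: nat
  proof -
    have "min c1 c2 * \<sigma>\<^sup>2 * real k * t \<le> c * \<sigma>\<^sup>2 * real k * t"
      using that by (intro mult_right_mono) auto
    then show ?thesis using that(1) by (meson ennreal_leI order_trans)
  qed
  show ?thesis
  proof (intro exI[of _ "min c1 c2"] conjI exI[of _ n0] allI impI)
    show "min c1 c2 > 0" using \<open>c1 > 0\<close> \<open>c2 > 0\<close> by simp
    fix d0 :: int assume d0: "-1 \<le> d0 \<and> d0 \<le> int d - 1"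
    define k0 where "k0 = \<lfloor>real (d + 1) / real_of_int (int d - d0)\<rfloor> + 1"
    define K where "K = nat k0"
    define g where "g = real_of_int (int d - d0)"
    have g: "1 \<le> g" "g \<le> real (d + 1)" using d0 by (auto simp: g_def)
    have "real (d + 1) * 1 \<le> real (d + 1) * g" using g(1) by (rule mult_left_mono) simp
    then have "1 \<le> real (d + 1) / g" "real (d + 1) / g \<le> real (d + 1)"
      using g by (simp_all add: pos_divide_le_eq)
    then have k0: "2 \<le> k0" "k0 \<le> int d + 2" unfolding k0_def g_def[symmetric] by linarith+
    \<comment> \<open>The \<open>+ 1\<close> after the floor gives the strict inequality of the
      dimension count, so \<open>k0\<close> knots carry a bump.\<close>
    have "real (d + 1) / g < of_int k0" unfolding k0_def g_def[symmetric] by linarith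
    then have "real (d + 1) < of_int k0 * g" using g by (simp add: field_simps)
    then have "real_of_int (int (d + 1)) < real_of_int (k0 * (int d - d0))" by (simp add: g_def)
    then have "int (d + 1) < k0 * (int d - d0)" by (simp only: of_int_less_iff)
    moreover have "int (K * nat (int d - d0)) = k0 * (int d - d0)" using k0 d0 by (simp add: K_def)
    ultimately have "int (d + 1) < int (K * nat (int d - d0))" by (simp only:)
    then have K: "d + 1 < K * nat (int d - d0)" "2 \<le> K" "K \<le> d + 2" "int K = k0"
      using k0 by (simp_all only: of_nat_less_iff) (simp_all add: K_def)
    show "let k0 = \<lfloor>real (d + 1) / real_of_int (int d - d0)\<rfloor> + 1 in
      \<forall>(n::nat) (k::nat) (\<sigma>::real). n \<ge> n0 \<and> 2 \<le> k \<and> k \<le> n \<and> \<sigma> > 0 \<longrightarrow>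
        (int k \<le> k0 \<longrightarrow>
           minimax_risk n \<sigma> (spline_vectors n d d0 k)
             \<ge> ennreal (min c1 c2 * \<sigma>\<^sup>2 * real k * ln (ln (16 * real n / real k)))) \<and>
        (int k \<ge> k0 + 1 \<longrightarrow>
           minimax_risk n \<sigma> (spline_vectors n d d0 k)
             \<ge> ennreal (min c1 c2 * \<sigma>\<^sup>2 * real k * ln (exp 1 * real n / real k)))"
      unfolding Let_def k0_def[symmetric]
    proof (intro allI impI conjI; elim conjE)
      fix n k :: nat and \<sigma> :: real
      assume n: "n0 \<le> n" and k: "2 \<le> k" "k \<le> n" and \<sigma>: "0 < \<sigma>"
      show "ennreal (min c1 c2 * \<sigma>\<^sup>2 * real k * ln (ln (16 * real n / real k)))
          \<le> minimax_risk n \<sigma> (spline_vectors n d d0 k)" if "int k \<le> k0"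
      proof (rule scale)
        show "ennreal (c1 * \<sigma>\<^sup>2 * real k * ln (ln (16 * real n / real k)))
            \<le> minimax_risk n \<sigma> (spline_vectors n d d0 k)"
          unfolding c1_def using n k \<sigma> d0 K that
          by (intro minimax_risk_few_pieces) (auto simp: n0_def E_def)
        have "exp 1 \<le> (16 :: real)" using exp_le by linarith
        also have "(16 :: real) \<le> 16 * real n / real k" using k by (simp add: field_simps)
        finally have "1 \<le> ln (16 * real n / real k)"
          using k by (subst ln_ge_iff) auto
        then show "0 \<le> ln (ln (16 * real n / real k))" by simp
      qed simp
      show "ennreal (min c1 c2 * \<sigma>\<^sup>2 * real k * ln (exp 1 * real n / real k))
          \<le> minimax_risk n \<sigma> (spline_vectors n d d0 k)" if "k0 + 1 \<le> int k"
      proof (rule scale)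
        show "ennreal (c2 * \<sigma>\<^sup>2 * real k * ln (exp 1 * real n / real k))
            \<le> minimax_risk n \<sigma> (spline_vectors n d d0 k)"
          unfolding c2_def C_def A_def using n k \<sigma> d0 K that
          by (intro minimax_risk_many_pieces) (auto simp: n0_def A_def)
        have "1 * 1 \<le> exp 1 * (real n / real k)"
          using k by (intro mult_mono) auto
        then show "0 \<le> ln (exp 1 * real n / real k)" by (intro ln_ge_zero) simp
      qed simp
    qed
  qed
qed

end
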